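(* Let $n\in\mathbb{N}=\{1,2,\dots\}$ and let $I=\{i_1<\dots<i_l\}\subseteq\{0,1,\dots,n-1\}$. Then $$\sum_{w\in B_n^{I^c}}(-1)^{l(w)}X^{L(w)}=f_{n,I}(X).$$
   Context: The hyperoctahedral group $B_n$ is the group of bijections $w$ of $\{-n,\dots,n\}$ with $w(-i)=-w(i)$ for all $i$ (so $w(0)=0$); write $w=[w(1),\dots,w(n)]$. It is a Coxeter group with generators $s_0=[-1,2,3,\dots,n]$ and $s_i=[1,\dots,i-1,i+1,i,i+2,\dots,n]$ for $1\le i\le n-1$; $l(w)$ denotes the Coxeter length. The descent set is $D(w)=\{i\in\{0,\dots,n-1\}: w(i)>w(i+1)\}$ (using $w(0)=0$). For $I\subseteq\{0,\dots,n-1\}$ write $I^c=\{0,\dots,n-1\}\setminus I$ and $B_n^{I^c}=\{w\in B_n: D(w)\subseteq I\}$. The statistic $L$ is $$L(w)=\tfrac12\left|\{(i,j)\in\{-n,\dots,n\}^2: i<j,\ w(i)>w(j),\ i\not\equiv j \pmod 2\}\right|.$$ Polynomials in $X$: $(\underline{k})=1-X^k$ for $k>0$ and $(\underline{0})=1$; $(\underline{k})!=\prod_{i=1}^k(\underline{i})$ (so $(\underline 0)!=1$); $(\underline{k})!!=\prod_{1\le i\le k,\ i\text{ even}}(\underline{i})$. For $I=\{i_1<\dots<i_l\}$ with $l\ge1$ put $j_t=i_{t+1}-i_t$ for $1\le t<l$ and $j_l=n-i_l$, and $$f_{n,I}(X)=\frac{(\underline n)!}{(\underline{i_1})!\cdot\prod_{k=1}^{l}(\underline{j_k})!!}.$$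 For $I=\emptyset$, $f_{n,\emptyset}(X)=1$. *)

theory Defs
  imports
    "HOL-Combinatorics.Permutations"
    "HOL-Computational_Algebra.Polynomial_Factorial"
begin

text \<open>
  Elements of the group are functions on all of \<open>int\<close> that are the identity outside
  \<open>{-n..n}\<close>, so that each signed permutation has exactly one representative.
\<close>
definition hyperoct :: "nat \<Rightarrow> (int \<Rightarrow> int) set" where
  "hyperoct n = {w. w permutes {- int n..int n} \<and> (\<forall>i\<in>{- int n..int n}. w (- i) = - w i)}"

definition coxeter_gen :: "nat \<Rightarrow> int \<Rightarrow> int" where
  "coxeter_gen i =
     (if i = 0 then transpose (- 1) 1
      else transpose (int i) (int i + 1) \<circ> transpose (- int i) (- (int i + 1)))"

definition coxeter_length :: "nat \<Rightarrow> (int \<Rightarrow> int) \<Rightarrow> nat" where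
  "coxeter_length n w =
     (LEAST k. \<exists>is. length is = k \<and> set is \<subseteq> {0..<n} \<and> w = foldr (\<circ>) (map coxeter_gen is) id)"

definition descents :: "nat \<Rightarrow> (int \<Rightarrow> int) \<Rightarrow> nat set" where
  "descents n w = {i \<in> {0..<n}. w (int i) > w (int i + 1)}"

text \<open>
  \<open>hyperoct_desc n I\<close> is the parabolic quotient written \<open>B\<^sub>n\<close> with superscript \<open>{0..<n} - I\<close>.
\<close>
definition hyperoct_desc :: "nat \<Rightarrow> nat set \<Rightarrow> (int \<Rightarrow> int) set" where
  "hyperoct_desc n I = {w \<in> hyperoct n. descents n w \<subseteq> I}"

definition odd_inversions :: "nat \<Rightarrow> (int \<Rightarrow> int) \<Rightarrow> (int \<times> int) set" where
  "odd_inversions n w =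
     {(i, j) \<in> {- int n..int n} \<times> {- int n..int n}. i < j \<and> w i > w j \<and> \<not> i mod 2 = j mod 2}"

definition odd_length :: "nat \<Rightarrow> (int \<Rightarrow> int) \<Rightarrow> nat" where
  "odd_length n w = card (odd_inversions n w) div 2"

text \<open>The division by two in \<^const>\<open>odd_length\<close> is exact:\<close>
lemma even_card_odd_inversions:
  assumes "w \<in> hyperoct n"
  shows "even (card (odd_inversions n w))"
proof -
  let ?A = "{p \<in> odd_inversions n w. fst p + snd p > 0}"
  let ?B = "{p \<in> odd_inversions n w. fst p + snd p < 0}"
  let ?f = "\<lambda>(i, j). (- j, - i) :: int \<times> int"
  have fin: "finite (odd_inversions n w)"
    by (rule finite_subset[of _ "{- int n..int n} \<times> {- int n..int n}"])
       (auto simp: odd_inversions_def)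
  have closed: "?f p \<in> odd_inversions n w" if "p \<in> odd_inversions n w" for p
  proof -
    obtain i j where p: "p = (i, j)" by (cases p)
    have "w (- i) = - w i" "w (- j) = - w j"
      using assms that by (auto simp: p hyperoct_def odd_inversions_def)
    moreover have "- j mod 2 \<noteq> - i mod 2" if "i mod 2 \<noteq> j mod 2"
      using that by presburger
    ultimately show ?thesis
      using that by (auto simp: p odd_inversions_def)
  qed
  have "bij_betw ?f ?A ?B"
  proof (rule bij_betw_byWitness[where f' = ?f])
    show "?f ` ?A \<subseteq> ?B" using closed by fastforce
    show "?f ` ?B \<subseteq> ?A" using closed by fastforce
  qed auto
  then have eq: "card ?A = card ?B"
    by (rule bij_betw_same_card)
  have "i + j \<noteq> 0" if "(i, j) \<in> odd_inversions n w" for i j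
  proof -
    have "i mod 2 \<noteq> j mod 2" using that by (simp add: odd_inversions_def)
    then show ?thesis by presburger
  qed
  then have un: "odd_inversions n w = ?A \<union> ?B"
    by (force simp: neq_iff)
  have "card (?A \<union> ?B) = card ?A + card ?B"
    by (rule card_Un_disjoint) (use fin in auto)
  then show ?thesis
    using eq un by simp
qed

definition qnum :: "nat \<Rightarrow> int poly" where
  "qnum k = (if k = 0 then 1 else 1 - monom 1 k)"

definition qfact :: "nat \<Rightarrow> int poly" where
  "qfact k = (\<Prod>i = 1..k. qnum i)"

definition qdfact :: "nat \<Rightarrow> int poly" where
  "qdfact k = (\<Prod>i \<in> {i \<in> {1..k}. even i}. qnum i)"

text \<open>
  For \<open>I = {i\<^sub>1 < \<dots> < i\<^sub>l}\<close> and \<open>1 \<le> t \<le> l\<close>, \<open>elt I t\<close> is \<open>i\<^sub>t\<close> and \<open>gap n I t\<close> is \<open>j\<^sub>t\<close>.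
\<close>
definition elt :: "nat set \<Rightarrow> nat \<Rightarrow> nat" where
  "elt I t = sorted_list_of_set I ! (t - 1)"

definition gap :: "nat \<Rightarrow> nat set \<Rightarrow> nat \<Rightarrow> nat" where
  "gap n I t = (if t < card I then elt I (t + 1) - elt I t else n - elt I t)"

text \<open>
  The quotient is taken in the fraction field of the polynomial ring, so that no divisibility
  is presupposed.
\<close>
definition f_frac :: "nat \<Rightarrow> nat set \<Rightarrow> int poly fract" where
  "f_frac n I =
     (if I = {} then 1
      else to_fract (qfact n) /
           to_fract (qfact (elt I 1) * (\<Prod>k = 1..card I. qdfact (gap n I k))))"

end

theory Submission imports Defs
begin

text \<open>
  Write every \<open>w\<close> with descents in \<open>I\<close> as \<open>w = u \<circ> v\<close>, where \<open>m\<close> is the largest element of \<open>I\<close>, \<open>u\<close>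
  has its only descent at \<open>m\<close>, and \<open>v\<close> is a signed permutation of \<open>{-m..m}\<close>. For fixed \<open>u\<close>, multiplying
  \<open>v\<close> from the left by a generator that exchanges two values in positions of equal parity changes the
  sign but not \<open>L(w)\<close>; hence only the parity-preserving \<open>v\<close> contribute, and for these
  \<open>L(u \<circ> v) = L(u) + L(v)\<close>. So the sum for \<open>(n, I)\<close> is the product of the sums for \<open>(n, {m})\<close> and
  \<open>(m, I - {m})\<close>. In the case of a single descent, deleting the value \<open>\<plusminus>n\<close>, which can only sit at
  position \<open>n\<close>, \<open>m\<close> or \<open>m + 1\<close>, gives a recursion between \<open>L\<close> and the variant of \<open>L\<close> in which the parity
  condition is reversed for pairs of positions on different sides of \<open>m\<close>. Both sums have a closed form.
\<close>

section \<open>Signed permutations and their inversions\<close>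

text \<open>The obstacle is that \<open>L\<close> is not additive under
  \<open>w = u \<circ> v\<close>: whether an inversion between a position up to \<open>m\<close> and
  a later one counts depends on parity, and \<open>v\<close> moves values between positions of both
  parities. This dependence passes through one set, the values that \<open>v\<close> places at even
  positions. Cancellation inside the classes where this set is constant is thus compatible with
  every \<open>u\<close>, and one class survives. A generator reverses a single pair of positions;
  if both have the same parity, \<open>L\<close> does not see that pair. Since \<open>L\<close> does
  see every pair \<open>(k, k + 1)\<close>, descents are preserved too. The recursion leads out of
  \<open>L\<close> because deleting a position moves the later ones by one, which changes the parity
  of \<open>i + j\<close> exactly for pairs on opposite sides of the gap; a second deletion changes
  it back. The sum for the variant is 0 if \<open>n - m\<close> is odd and
  \<open>X^((n - m)/2)\<close> times the sum for \<open>L\<close> otherwise; for even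
  \<open>n - m\<close> the two recursions are then the two forms of the q-Pascal rule.\<close>

lemma hyperoct_permutes: "w \<in> hyperoct n \<Longrightarrow> w permutes {- int n..int n}"
  by (simp add: hyperoct_def)

lemma hyperoct_minus:
  assumes "w \<in> hyperoct n"
  shows "w (- i) = - w i"
proof (cases "i \<in> {- int n..int n}")
  case True
  then show ?thesis using assms by (simp add: hyperoct_def)
next
  case False
  then have "- i \<notin> {- int n..int n}" by auto
  then show ?thesis
    using False permutes_not_in[OF hyperoct_permutes[OF assms]] by metis
qed

lemma hyperoctI: "w permutes {- int n..int n} \<Longrightarrow> (\<And>i. w (- i) = - w i) \<Longrightarrow> w \<in> hyperoct n"
  by (simp add: hyperoct_def)

lemma hyperoct_zero: "w \<in> hyperoct n \<Longrightarrow> w 0 = 0"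
  using hyperoct_minus[of w n 0] by simp

lemma hyperoct_id: "id \<in> hyperoct n"
  by (simp add: hyperoct_def permutes_id)

lemma hyperoct_comp: "u \<in> hyperoct n \<Longrightarrow> v \<in> hyperoct n \<Longrightarrow> u \<circ> v \<in> hyperoct n"
  by (intro hyperoctI permutes_compose) (auto simp: hyperoct_permutes hyperoct_minus)

lemma hyperoct_bij: "w \<in> hyperoct n \<Longrightarrow> bij w"
  using hyperoct_permutes permutes_bij by blast

lemma hyperoct_eq_iff: "w \<in> hyperoct n \<Longrightarrow> w i = w j \<longleftrightarrow> i = j"
  using hyperoct_bij bij_is_inj inj_eq by metis

lemma hyperoct_inv:
  assumes "w \<in> hyperoct n"
  shows "inv w \<in> hyperoct n"
proof (rule hyperoctI)
  show "inv w permutes {- int n..int n}"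
    using assms by (simp add: hyperoct_permutes permutes_inv)
  fix i
  have "w (- inv w i) = - i"
    using assms by (simp add: hyperoct_minus surj_f_inv_f[OF bij_is_surj[OF hyperoct_bij]])
  then show "inv w (- i) = - inv w i"
    using assms hyperoct_bij bij_inv_eq_iff by metis
qed

lemma hyperoct_mono: "m \<le> n \<Longrightarrow> w \<in> hyperoct m \<Longrightarrow> w \<in> hyperoct n"
  by (rule hyperoctI) (auto intro: permutes_subset hyperoct_permutes simp: hyperoct_minus)

lemma hyperoct_abs_le: "w \<in> hyperoct n \<Longrightarrow> \<bar>w i\<bar> \<le> int n \<longleftrightarrow> \<bar>i\<bar> \<le> int n"
  using permutes_in_image[OF hyperoct_permutes, of w n i] by (auto simp: abs_le_iff)

lemma hyperoct_fixed: "w \<in> hyperoct n \<Longrightarrow> \<bar>i\<bar> > int n \<Longrightarrow> w i = i"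
  by (rule permutes_not_in[OF hyperoct_permutes]) auto

lemma hyperoct_abs_eq_iff:
  assumes "w \<in> hyperoct n"
  shows "\<bar>w i\<bar> = \<bar>w j\<bar> \<longleftrightarrow> \<bar>i\<bar> = \<bar>j\<bar>"
  using hyperoct_eq_iff[OF assms, of i j] hyperoct_eq_iff[OF assms, of i "- j"]
  by (auto simp: abs_eq_iff hyperoct_minus[OF assms])

lemma finite_hyperoct: "finite (hyperoct n)"
  by (rule finite_subset[OF _ finite_permutations[of "{- int n..int n}"]])
     (auto simp: hyperoct_permutes)

lemma finite_hyperoct_desc: "finite (hyperoct_desc n I)"
  using finite_hyperoct by (simp add: hyperoct_desc_def)

lemma increasing_int_interval:
  fixes x :: "int \<Rightarrow> int"
  assumes "\<And>i. a \<le> i \<Longrightarrow> i < b \<Longrightarrow> x i < x (i + 1)" "a \<le> i" "i < j" "j \<le> b"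
  shows "x i < x j"
proof -
  have "j \<le> b \<longrightarrow> x i < x j"
    using assms(3)
  proof (induction j rule: int_gr_induct)
    case base
    then show ?case using assms(1)[of i] assms(2) by auto
  next
    case (step k)
    then show ?case using assms(1)[of k] assms(2) by force
  qed
  then show ?thesis using assms(4) by simp
qed

text \<open>Counting up from \<open>x 0 = 0\<close> gives \<open>k \<le> x k\<close>, counting down
  from \<open>x n \<le> n\<close> gives \<open>x k \<le> k\<close>. This also yields the uniqueness
  of the factorization \<open>u \<circ> v\<close> and a length-reducing generator for every
  \<open>w \<noteq> id\<close>.\<close>

lemma hyperoct_increasing_eq_id:
  assumes x: "x \<in> hyperoct n" and inc: "\<And>i. 0 \<le> i \<Longrightarrow> i < int n \<Longrightarrow> x i < x (i + 1)"
  shows "x = id"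
proof -
  have lower: "k \<le> int n \<longrightarrow> k \<le> x k" if "k \<ge> 0" for k
    using that
  proof (induction k rule: int_ge_induct)
    case base
    then show ?case using hyperoct_zero[OF x] by simp
  next
    case (step k)
    then show ?case using inc[of k] by force
  qed
  have upper: "0 \<le> k \<longrightarrow> x k \<le> k" if "k \<le> int n" for k
    using that
  proof (induction k rule: int_le_induct)
    case base
    then show ?case using hyperoct_abs_le[OF x, of "int n"] by auto
  next
    case (step k)
    then show ?case using inc[of "k - 1"] by force
  qed
  have pos: "x k = k" if "k \<ge> 0" for k
    using lower[OF that] upper[of k] that hyperoct_fixed[OF x, of k] by force
  have "x k = k" for k
    using pos[of k] pos[of "- k"] hyperoct_minus[OF x, of k] by (cases "k \<ge> 0") auto
  then show ?thesis by auto
qed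

lemma hyperoct_desc_iff:
  "w \<in> hyperoct_desc n I \<longleftrightarrow> w \<in> hyperoct n \<and>
     (\<forall>i. 0 \<le> i \<longrightarrow> i < int n \<longrightarrow> nat i \<notin> I \<longrightarrow> w i < w (i + 1))"
proof -
  have "\<not> w (i + 1) < w i \<longleftrightarrow> w i < w (i + 1)" if "w \<in> hyperoct n" for i
    using hyperoct_eq_iff[OF that, of i "i + 1"] by auto
  moreover have "descents n w \<subseteq> I \<longleftrightarrow>
      (\<forall>i. 0 \<le> i \<longrightarrow> i < int n \<longrightarrow> nat i \<notin> I \<longrightarrow> \<not> w (i + 1) < w i)"
  proof -
    have "descents n w \<subseteq> I \<longleftrightarrow> (\<forall>i<n. i \<notin> I \<longrightarrow> \<not> w (int i + 1) < w (int i))"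
      by (auto simp: descents_def)
    also have "\<dots> \<longleftrightarrow> (\<forall>i. 0 \<le> i \<longrightarrow> i < int n \<longrightarrow> nat i \<notin> I \<longrightarrow> \<not> w (i + 1) < w i)"
      (is "?P \<longleftrightarrow> ?Q")
    proof
      assume P: ?P
      show ?Q
      proof (intro allI impI)
        fix i assume i: "0 \<le> i" "i < int n" "nat i \<notin> I"
        then show "\<not> w (i + 1) < w i" using P[rule_format, of "nat i"] by (simp add: nat_less_iff)
      qed
    next
      assume Q: ?Q
      show ?P
      proof (intro allI impI)
        fix i assume "i < n" "i \<notin> I"
        then show "\<not> w (int i + 1) < w (int i)" using Q[rule_format, of "int i"] by simp
      qed
    qed
    finally show ?thesis .
  qed
  ultimately show ?thesis
    by (simp add: hyperoct_desc_def cong: conj_cong)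
qed

text \<open>The intersection with \<open>{0..<n}\<close> admits \<open>I = {n}\<close>, the form in
  which the empty outer block occurs in \<open>block_sum_0\<close>.\<close>

lemma hyperoct_desc_no_descents:
  assumes "I \<inter> {0..<n} = {}" shows "hyperoct_desc n I = {id}"
proof -
  have "nat i \<notin> I" if "0 \<le> i" "i < int n" for i
    using assms that by force
  then have "w = id" if "w \<in> hyperoct_desc n I" for w
    using that hyperoct_increasing_eq_id[of w n] by (auto simp: hyperoct_desc_iff)
  moreover have "id \<in> hyperoct_desc n I"
    by (auto simp: hyperoct_desc_iff hyperoct_id)
  ultimately show ?thesis by blast
qed

text \<open>The pairs with \<open>\<bar>i\<bar> < j\<close> index the positive roots of type B:
  \<open>e_j\<close> for \<open>i = 0\<close>, \<open>e_j - e_i\<close> for \<open>i > 0\<close> and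
  \<open>e_j + e_\<bar>i\<bar>\<close> for \<open>i < 0\<close>. The filter \<open>Q\<close> sees
  absolute positions, so one set of lemmas serves the sign, \<open>L\<close> and its
  variant.\<close>

definition invs :: "(int \<Rightarrow> int \<Rightarrow> bool) \<Rightarrow> nat \<Rightarrow> (int \<Rightarrow> int) \<Rightarrow> (int \<times> int) set" where
  "invs Q n w = {(i, j). \<bar>i\<bar> < j \<and> j \<le> int n \<and> Q \<bar>i\<bar> j \<and> w j < w i}"

abbreviation all_pairs :: "int \<Rightarrow> int \<Rightarrow> bool" where
  "all_pairs \<equiv> \<lambda>_ _. True"

definition odd_pairs :: "int \<Rightarrow> int \<Rightarrow> bool" where
  "odd_pairs a b \<longleftrightarrow> odd (a + b)"

lemma finite_invs: "finite (invs Q n w)"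
  by (rule finite_subset[of _ "{- int n..int n} \<times> {- int n..int n}"]) (auto simp: invs_def)

text \<open>The map \<open>(i, j) \<mapsto> (- j, - i)\<close> pairs up the odd inversions. Parity
  excludes \<open>i + j = 0\<close>, so exactly one member of each pair has
  \<open>\<bar>i\<bar> < j\<close>.\<close>

lemma odd_length_eq_card_invs:
  assumes w: "w \<in> hyperoct n"
  shows "odd_length n w = card (invs odd_pairs n w)"
proof -
  let ?A = "invs odd_pairs n w"
  let ?f = "\<lambda>(i, j). (- j, - i) :: int \<times> int"
  note minus = hyperoct_minus[OF w]
  have "odd_inversions n w = ?A \<union> ?f ` ?A"
  proof (intro set_eqI iffI)
    fix p assume p: "p \<in> odd_inversions n w"
    obtain i j where ij: "p = (i, j)" by (cases p)
    then have h: "- int n \<le> i" "i \<le> int n" "- int n \<le> j" "j \<le> int n" "i < j" "w j < w i"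
      "i mod 2 \<noteq> j mod 2"
      using p by (auto simp: odd_inversions_def)
    have o: "odd (\<bar>i\<bar> + j)" "odd (\<bar>j\<bar> - i)" and "i + j \<noteq> 0"
      using h(7) by (auto simp: abs_if) presburger+
    then consider "\<bar>i\<bar> < j" | "\<bar>j\<bar> < - i" using h(5) by linarith
    then show "p \<in> ?A \<union> ?f ` ?A"
    proof cases
      case 1
      then show ?thesis using h o by (auto simp: ij invs_def odd_pairs_def)
    next
      case 2
      then have "(- j, - i) \<in> ?A" using h o by (auto simp: invs_def odd_pairs_def minus)
      then show ?thesis by (force simp: ij image_iff)
    qed
  next
    have main: "(i, j) \<in> odd_inversions n w \<and> (- j, - i) \<in> odd_inversions n w"
      if "(i, j) \<in> ?A" for i j
    proof -
      have o: "odd (i + j)" using that by (simp add: invs_def odd_pairs_def even_abs_add_iff)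
      have "i mod 2 \<noteq> j mod 2" "(- j) mod 2 \<noteq> (- i) mod 2"
        using o by presburger+
      then show ?thesis using that by (auto simp: invs_def odd_pairs_def odd_inversions_def minus)
    qed
    fix p assume "p \<in> ?A \<union> ?f ` ?A"
    then show "p \<in> odd_inversions n w" using main by (cases p) auto
  qed
  moreover have "?A \<inter> ?f ` ?A = {}" by (auto simp: invs_def odd_pairs_def)
  moreover have "inj_on ?f ?A" by (auto simp: inj_on_def)
  ultimately have "card (odd_inversions n w) = card ?A + card ?A"
    by (simp add: card_Un_disjoint finite_invs card_image)
  then show ?thesis by (simp add: odd_length_def)
qed

section \<open>Coxeter generators acting from the left\<close>

lemma coxeter_gen_apply:
  "coxeter_gen r x =
     (if r = 0 then if \<bar>x\<bar> = 1 then - x else x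
      else if x = int r then int r + 1 else if x = int r + 1 then int r
      else if x = - int r then - (int r + 1) else if x = - (int r + 1) then - int r else x)"
  by (auto simp: coxeter_gen_def transpose_def abs_if)

lemma coxeter_gen_involution: "coxeter_gen r \<circ> coxeter_gen r = id"
  by (auto simp: fun_eq_iff coxeter_gen_apply)

lemma coxeter_gen_hyperoct:
  assumes "r < n" shows "coxeter_gen r \<in> hyperoct n"
proof (rule hyperoctI)
  have "coxeter_gen r x = x" if "x \<notin> {- int n..int n}" for x
    using that assms by (auto simp: coxeter_gen_apply)
  then show "coxeter_gen r permutes {- int n..int n}"
    using coxeter_gen_involution[of r] by (auto simp: permutes_def fun_eq_iff) metis+
qed (auto simp: coxeter_gen_apply)

text \<open>Exchanging adjacent values affects only their mutual order. Signs are compared weakly so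
  that the formula also covers \<open>r = 0\<close>, where one of the two values is 0.\<close>

lemma coxeter_gen_less_iff:
  assumes "\<bar>x\<bar> \<noteq> \<bar>y\<bar>"
  shows "coxeter_gen r y < coxeter_gen r x \<longleftrightarrow>
    (y < x) \<noteq> ((\<bar>x\<bar> = int r \<and> \<bar>y\<bar> = int r + 1 \<or> \<bar>x\<bar> = int r + 1 \<and> \<bar>y\<bar> = int r) \<and>
      (0 \<le> x \<and> 0 \<le> y \<or> x \<le> 0 \<and> y \<le> 0))"
proof (cases "r = 0")
  case True
  then show ?thesis
    using assms by (simp add: coxeter_gen_apply) linarith
next
  case False
  then have "int r > 0" by simp
  moreover have "coxeter_gen r z = (if z = int r then int r + 1 else if z = int r + 1 then int r
      else if z = - int r then - (int r + 1) else if z = - (int r + 1) then - int r else z)" for z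
    using False by (simp add: coxeter_gen_apply)
  ultimately show ?thesis
    using assms by smt
qed

section \<open>The sign-reversing involution\<close>

text \<open>
  Left multiplication by a generator reverses exactly one of the inversion-relevant pairs of
  positions, namely the one that holds the values \<open>r\<close> and \<open>r + 1\<close> up to a common sign.
\<close>
lemma invs_coxeter_gen_comp:
  assumes w: "w \<in> hyperoct n" and r: "r < n"
  obtains i j where "\<bar>i\<bar> < j" "j \<le> int n"
    "\<bar>w i\<bar> = int r \<and> \<bar>w j\<bar> = int r + 1 \<or> \<bar>w i\<bar> = int r + 1 \<and> \<bar>w j\<bar> = int r"
    "0 \<le> w i \<and> 0 \<le> w j \<or> w i \<le> 0 \<and> w j \<le> 0"
    "\<And>Q. invs Q n (coxeter_gen r \<circ> w) =
       (if Q \<bar>i\<bar> j then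
          if w j < w i then invs Q n w - {(i, j)} else insert (i, j) (invs Q n w)
        else invs Q n w)"
proof -
  define a where "a = inv w (int r)"
  define b where "b = inv w (int r + 1)"
  have ab: "w a = int r" "w b = int r + 1"
    unfolding a_def b_def using w by (simp_all add: surj_f_inv_f[OF bij_is_surj[OF hyperoct_bij]])
  have neq: "\<bar>a\<bar> \<noteq> \<bar>b\<bar>"
    using hyperoct_abs_eq_iff[OF w, of a b] ab by auto
  have le: "\<bar>a\<bar> \<le> int n" "\<bar>b\<bar> \<le> int n"
    using hyperoct_abs_le[OF w, of a] hyperoct_abs_le[OF w, of b] ab r by auto
  define rel where "rel i j \<longleftrightarrow>
    (\<bar>w i\<bar> = int r \<and> \<bar>w j\<bar> = int r + 1 \<or> \<bar>w i\<bar> = int r + 1 \<and> \<bar>w j\<bar> = int r) \<and>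
    (0 \<le> w i \<and> 0 \<le> w j \<or> w i \<le> 0 \<and> w j \<le> 0)" for i j
  \<comment> \<open>Of the positions \<open>a\<close> and \<open>b\<close> of the values
    \<open>r\<close> and \<open>r + 1\<close>, \<open>c\<close> is the one farther from 0; a common
    change of sign makes it positive, so that \<open>(i, j)\<close> has the shape counted by
    \<open>invs\<close>.\<close>
  define c where "c = (if \<bar>a\<bar> < \<bar>b\<bar> then b else a)"
  define d where "d = (if \<bar>a\<bar> < \<bar>b\<bar> then a else b)"
  define j where "j = \<bar>c\<bar>"
  define i where "i = (if c < 0 then - d else d)"
  have ij: "\<bar>i\<bar> < j" "j \<le> int n"
    using neq le by (auto simp: i_def j_def c_def d_def)
  have rel: "rel i j"
    using ab by (auto simp: rel_def i_def j_def c_def d_def hyperoct_minus[OF w] abs_if)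
  have unique: "i' = i \<and> j' = j" if "rel i' j'" "\<bar>i'\<bar> < j'" for i' j'
  proof -
    have "\<bar>w i'\<bar> = \<bar>w i\<bar> \<and> \<bar>w j'\<bar> = \<bar>w j\<bar> \<or> \<bar>w i'\<bar> = \<bar>w j\<bar> \<and> \<bar>w j'\<bar> = \<bar>w i\<bar>"
      using that(1) rel by (auto simp: rel_def)
    then have abs: "\<bar>i'\<bar> = \<bar>i\<bar> \<and> j' = j"
      using that(2) ij by (auto simp: hyperoct_abs_eq_iff[OF w])
    \<comment> \<open>As \<open>w j\<close> is nonzero, \<open>i\<close> and \<open>- i\<close> can
      both meet the sign condition only if \<open>w i = 0\<close>.\<close>
    moreover have "i' = i" if "i' = - i"
    proof -
      have "w j \<noteq> 0"
        using ij hyperoct_eq_iff[OF w, of j 0] hyperoct_zero[OF w] by auto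
      then have "w i = 0"
        using that \<open>rel i' j'\<close> rel abs by (auto simp: rel_def hyperoct_minus[OF w])
      then have "i = 0" using hyperoct_eq_iff[OF w, of i 0] hyperoct_zero[OF w] by simp
      then show ?thesis using that by simp
    qed
    ultimately show ?thesis by (auto simp: abs_eq_iff)
  qed
  have less: "coxeter_gen r (w j') < coxeter_gen r (w i') \<longleftrightarrow> (w j' < w i') \<noteq> (i' = i \<and> j' = j)"
    if "\<bar>i'\<bar> < j'" for i' j'
  proof -
    have "\<bar>w i'\<bar> \<noteq> \<bar>w j'\<bar>" using that by (auto simp: hyperoct_abs_eq_iff[OF w])
    then show ?thesis
      using coxeter_gen_less_iff[of "w i'" "w j'" r] unique[of i' j'] rel that
      unfolding rel_def by blast
  qed
  have "invs Q n (coxeter_gen r \<circ> w) =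
       (if Q \<bar>i\<bar> j then
          if w j < w i then invs Q n w - {(i, j)} else insert (i, j) (invs Q n w)
        else invs Q n w)" for Q
    using ij by (auto simp: invs_def less)
  then show ?thesis using that[of i j] ij rel unfolding rel_def by blast
qed

text \<open>By the root description of \<open>invs\<close>, the exponent is the classical inversion
  count for the length in type B. In this form the sign can be computed for compositions and
  insertions, to which a minimum over words gives no access.\<close>

definition cox_sign :: "nat \<Rightarrow> (int \<Rightarrow> int) \<Rightarrow> int poly" where
  "cox_sign n w = (- 1) ^ card (invs all_pairs n w)"

lemma cox_sign_gen_comp:
  assumes w: "w \<in> hyperoct n" and r: "r < n"
  shows "cox_sign n (coxeter_gen r \<circ> w) = - cox_sign n w"
proof -
  obtain i j where ij: "\<bar>i\<bar> < j" "j \<le> int n" and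
    eq: "invs all_pairs n (coxeter_gen r \<circ> w) =
       (if w j < w i then invs all_pairs n w - {(i, j)} else insert (i, j) (invs all_pairs n w))"
    using invs_coxeter_gen_comp[OF assms] by metis
  show ?thesis
  proof (cases "w j < w i")
    case True
    then have "(i, j) \<in> invs all_pairs n w" using ij by (simp add: invs_def)
    then have "card (invs all_pairs n w) = Suc (card (invs all_pairs n (coxeter_gen r \<circ> w)))"
      using True card_Suc_Diff1[OF finite_invs, of "(i, j)" all_pairs n w] by (simp add: eq)
    then show ?thesis by (simp add: cox_sign_def)
  next
    case False
    then have "(i, j) \<notin> invs all_pairs n w" by (simp add: invs_def)
    then have "card (invs all_pairs n (coxeter_gen r \<circ> w)) = Suc (card (invs all_pairs n w))"
      using False by (simp add: eq finite_invs)
    then show ?thesis by (simp add: cox_sign_def)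
  qed
qed

text \<open>If \<open>w \<noteq> id\<close>, its inverse decreases from some \<open>r\<close> to
  \<open>r + 1\<close>, and the generator \<open>r\<close> on the left removes an inversion.
  Generation ensures that the \<open>LEAST\<close> in \<open>coxeter_length\<close> is
  attained.\<close>

lemma hyperoct_generated:
  assumes "w \<in> hyperoct n"
  shows "\<exists>rs. set rs \<subseteq> {0..<n} \<and> w = foldr (\<circ>) (map coxeter_gen rs) id"
  using assms
proof (induction "card (invs all_pairs n w)" arbitrary: w rule: less_induct)
  case less
  note w = less.prems
  show ?case
  proof (cases "w = id")
    case True
    then show ?thesis by (intro exI[of _ "[]"]) auto
  next
    case False
    then have "inv w \<noteq> id"
      using hyperoct_bij[OF w] by (metis inv_id inv_inv_eq)
    then obtain r' where r': "0 \<le> r'" "r' < int n" "\<not> inv w r' < inv w (r' + 1)"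
      using hyperoct_increasing_eq_id[OF hyperoct_inv[OF w]] by blast
    define r where "r = nat r'"
    have r: "r < n" "inv w (int r) > inv w (int r + 1)"
      using r' hyperoct_eq_iff[OF hyperoct_inv[OF w], of r' "r' + 1"] by (auto simp: r_def)
    obtain i j where ij: "\<bar>i\<bar> < j" "j \<le> int n"
      "\<bar>w i\<bar> = int r \<and> \<bar>w j\<bar> = int r + 1 \<or> \<bar>w i\<bar> = int r + 1 \<and> \<bar>w j\<bar> = int r"
      "0 \<le> w i \<and> 0 \<le> w j \<or> w i \<le> 0 \<and> w j \<le> 0"
      and eq: "invs all_pairs n (coxeter_gen r \<circ> w) =
        (if w j < w i then invs all_pairs n w - {(i, j)} else insert (i, j) (invs all_pairs n w))"
      using invs_coxeter_gen_comp[OF w r(1)] by metis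
    have inv_w: "inv w (w x) = x" for x
      using bij_is_inj[OF hyperoct_bij[OF w]] by simp
    \<comment> \<open>Up to a common sign, \<open>i\<close> and \<open>j\<close> are the positions
      of \<open>r\<close> and \<open>r + 1\<close>, which stand in the wrong order by the choice of
      \<open>r\<close>; so the pair is removed, not added.\<close>
    have "w j < w i"
    proof (rule ccontr)
      assume "\<not> w j < w i"
      then consider "w i = int r" "w j = int r + 1" | "w i = - (int r + 1)" "w j = - int r"
        using ij(3,4) by linarith
      then show False
      proof cases
        case 1
        then have "inv w (int r) = i" "inv w (int r + 1) = j" using inv_w by metis+
        then show False using r ij(1) by simp
      next
        case 2
        then have "w (- i) = int r + 1" "w (- j) = int r" by (simp_all add: hyperoct_minus[OF w])
        then have "inv w (int r) = - j" "inv w (int r + 1) = - i" using inv_w by metis+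
        then show False using r ij(1) by simp
      qed
    qed
    then have "(i, j) \<in> invs all_pairs n w" using ij by (simp add: invs_def)
    then have "card (invs all_pairs n (coxeter_gen r \<circ> w)) < card (invs all_pairs n w)"
      using \<open>w j < w i\<close> card_Diff1_less[OF finite_invs, of "(i, j)" all_pairs n w] by (simp add: eq)
    then obtain rs where rs: "set rs \<subseteq> {0..<n}"
      "coxeter_gen r \<circ> w = foldr (\<circ>) (map coxeter_gen rs) id"
      using less.hyps hyperoct_comp[OF coxeter_gen_hyperoct[OF r(1)] w] by blast
    have "w = coxeter_gen r \<circ> (coxeter_gen r \<circ> w)"
      using coxeter_gen_involution[of r] by (simp add: comp_assoc[symmetric])
    then show ?thesis
      using rs r(1) by (intro exI[of _ "r # rs"]) simp
  qed
qed

lemma cox_sign_foldr: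
  assumes "set rs \<subseteq> {0..<n}"
  shows "foldr (\<circ>) (map coxeter_gen rs) id \<in> hyperoct n \<and>
    cox_sign n (foldr (\<circ>) (map coxeter_gen rs) id) = (- 1) ^ length rs"
  using assms
proof (induction rs)
  case Nil
  have "invs all_pairs n id = {}" by (auto simp: invs_def)
  then have "cox_sign n id = 1" by (simp add: cox_sign_def)
  moreover have "foldr (\<circ>) (map coxeter_gen []) id = id" by (simp add: fun_eq_iff)
  ultimately show ?case using hyperoct_id[of n] by (metis list.size(3) power_0)
next
  case (Cons r rs)
  let ?w = "foldr (\<circ>) (map coxeter_gen rs) id"
  have sub: "set rs \<subseteq> {0..<n}" and r: "r < n" using Cons.prems by auto
  note w = Cons.IH[OF sub, THEN conjunct1] Cons.IH[OF sub, THEN conjunct2]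
  have eq: "foldr (\<circ>) (map coxeter_gen (r # rs)) id = coxeter_gen r \<circ> ?w"
    by simp
  show ?case
    unfolding eq using hyperoct_comp[OF coxeter_gen_hyperoct[OF r] w(1)] cox_sign_gen_comp[OF w(1) r] w(2)
    by (simp only: list.size) simp
qed

text \<open>Every letter of a word flips the sign, so each word for \<open>w\<close>, in particular
  a shortest one, has length of the same parity.\<close>

lemma coxeter_length_sign:
  assumes "w \<in> hyperoct n"
  shows "(- 1) ^ coxeter_length n w = cox_sign n w"
proof -
  have "\<exists>rs. length rs = coxeter_length n w \<and> set rs \<subseteq> {0..<n} \<and>
      w = foldr (\<circ>) (map coxeter_gen rs) id"
    unfolding coxeter_length_def
    by (rule LeastI_ex) (use hyperoct_generated[OF assms] in blast)
  then show ?thesis using cox_sign_foldr by metis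
qed

section \<open>Weights and parity patterns\<close>

definition weight :: "(int \<Rightarrow> int \<Rightarrow> bool) \<Rightarrow> nat \<Rightarrow> (int \<Rightarrow> int) \<Rightarrow> int poly" where
  "weight Q n w = cox_sign n w * monom 1 (card (invs Q n w))"

definition signed_sum :: "nat \<Rightarrow> nat set \<Rightarrow> int poly" where
  "signed_sum n I = (\<Sum>w\<in>hyperoct_desc n I. weight odd_pairs n w)"

lemma signed_sum_eq:
  "(\<Sum>w\<in>hyperoct_desc n I. (- 1) ^ coxeter_length n w * monom 1 (odd_length n w)) = signed_sum n I"
  unfolding signed_sum_def
  by (rule sum.cong)
     (auto simp: weight_def hyperoct_desc_iff coxeter_length_sign odd_length_eq_card_invs)

text \<open>Encodes the parities of positions as a set of values: a position in range is even
  exactly if its value lies in the set. Left multiplication acts on it by taking images, so a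
  suitable generator can leave it unchanged.\<close>

definition even_image :: "nat \<Rightarrow> (int \<Rightarrow> int) \<Rightarrow> int set" where
  "even_image n w = w ` {i. \<bar>i\<bar> \<le> int n \<and> even i}"

lemma mem_even_image_iff:
  "w \<in> hyperoct n \<Longrightarrow> \<bar>i\<bar> \<le> int n \<Longrightarrow> w i \<in> even_image n w \<longleftrightarrow> even i"
  by (auto simp: even_image_def hyperoct_eq_iff)

lemma even_image_uminus:
  assumes "w \<in> hyperoct n" shows "- x \<in> even_image n w \<longleftrightarrow> x \<in> even_image n w"
proof -
  have "- x \<in> even_image n w" if "x \<in> even_image n w" for x
    using that unfolding even_image_def
    by (auto simp: hyperoct_minus[OF assms, symmetric] intro!: imageI)
  from this[of x] this[of "- x"] show ?thesis by auto
qed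

text \<open>If membership alternated all the way up from \<open>0\<close>, which is the value of the
  even position \<open>0\<close>, the set would be that of the even numbers.\<close>

lemma even_image_not_alternating:
  assumes v: "v \<in> hyperoct n" and neq: "even_image n v \<noteq> {i. \<bar>i\<bar> \<le> int n \<and> even i}"
  obtains r where "r < n" "int r \<in> even_image n v \<longleftrightarrow> int r + 1 \<in> even_image n v"
proof -
  have "\<exists>r<n. int r \<in> even_image n v \<longleftrightarrow> int r + 1 \<in> even_image n v"
  proof (rule ccontr)
    assume "\<not> ?thesis"
    then have alt: "int r \<in> even_image n v \<longleftrightarrow> int r + 1 \<notin> even_image n v" if "r < n" for r
      using that by blast
    have nonneg: "int k \<in> even_image n v \<longleftrightarrow> even k" if "k \<le> n" for k
      using that
    proof (induction k)
      case 0
      then show ?case using mem_even_image_iff[OF v, of 0] hyperoct_zero[OF v] by simp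
    next
      case (Suc k)
      then show ?case using alt[of k] by (auto simp: algebra_simps)
    qed
    have "x \<in> even_image n v \<longleftrightarrow> even x" if "\<bar>x\<bar> \<le> int n" for x
    proof -
      have "nat \<bar>x\<bar> \<le> n" using that by simp
      then have "\<bar>x\<bar> \<in> even_image n v \<longleftrightarrow> even x" using nonneg[of "nat \<bar>x\<bar>"] by (simp add: even_nat_iff)
      then show ?thesis using even_image_uminus[OF v, of x] by (auto simp: abs_if split: if_splits)
    qed
    moreover have "\<bar>x\<bar> \<le> int n" if "x \<in> even_image n v" for x
      using that hyperoct_abs_le[OF v] by (auto simp: even_image_def)
    ultimately show False using neq by blast
  qed
  then show ?thesis using that by blast
qed

lemma coxeter_gen_image_closed:
  assumes "\<And>x. - x \<in> E \<longleftrightarrow> x \<in> E" "int r \<in> E \<longleftrightarrow> int r + 1 \<in> E"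
  shows "coxeter_gen r ` E = E"
proof -
  have mem: "coxeter_gen r x \<in> E \<longleftrightarrow> x \<in> E" for x
    using assms(2) assms(1)[of x] assms(1)[of "int r"] assms(1)[of "int r + 1"]
    by (auto simp: coxeter_gen_apply)
  have "coxeter_gen r (coxeter_gen r x) = x" for x
    using coxeter_gen_involution by (metis comp_apply id_apply)
  then have "x \<in> coxeter_gen r ` E" if "x \<in> E" for x
    using mem[of x] that by (metis imageI)
  then show ?thesis using mem by blast
qed

text \<open>
  On the set of all \<open>v\<close> with a given \<open>even_image\<close> other than the even numbers, left multiplication
  by a single suitable generator is a sign-reversing involution that preserves the odd length.
\<close>
lemma even_image_fibre_sum_zero:
  assumes neq: "E \<noteq> {i. \<bar>i\<bar> \<le> int n \<and> even i}"
  shows "(\<Sum>v | v \<in> hyperoct_desc n J \<and> even_image n v = E. weight odd_pairs n v) = 0"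
    (is "(\<Sum>v \<in> ?F. _) = 0")
proof (cases "?F = {}")
  case True
  then show ?thesis by (simp only: sum.empty)
next
  case False
  \<comment> \<open>\<open>v0\<close> only supplies the symmetry of \<open>E\<close>;
    \<open>r\<close> depends on \<open>E\<close> alone, so one generator serves the whole
    fibre.\<close>
  then obtain v0 where v0: "v0 \<in> hyperoct n" "even_image n v0 = E"
    by (auto simp: hyperoct_desc_iff)
  obtain r where r: "r < n" "int r \<in> E \<longleftrightarrow> int r + 1 \<in> E"
    using even_image_not_alternating[OF v0(1)] v0(2) neq by metis
  have closed: "coxeter_gen r ` E = E"
    using coxeter_gen_image_closed[of E r] even_image_uminus[OF v0(1)] v0(2) r(2) by simp
  have step: "coxeter_gen r \<circ> v \<in> ?F \<and> weight odd_pairs n (coxeter_gen r \<circ> v) = - weight odd_pairs n v"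
    if "v \<in> ?F" for v
  proof -
    have v: "v \<in> hyperoct n" and E: "even_image n v = E"
      and inc: "\<And>i. 0 \<le> i \<Longrightarrow> i < int n \<Longrightarrow> nat i \<notin> J \<Longrightarrow> v i < v (i + 1)"
      using that by (auto simp: hyperoct_desc_iff)
    obtain i j where ij: "\<bar>i\<bar> < j" "j \<le> int n"
      "\<bar>v i\<bar> = int r \<and> \<bar>v j\<bar> = int r + 1 \<or> \<bar>v i\<bar> = int r + 1 \<and> \<bar>v j\<bar> = int r"
      "0 \<le> v i \<and> 0 \<le> v j \<or> v i \<le> 0 \<and> v j \<le> 0"
      and eq: "\<And>Q. invs Q n (coxeter_gen r \<circ> v) =
       (if Q \<bar>i\<bar> j then
          if v j < v i then invs Q n v - {(i, j)} else insert (i, j) (invs Q n v)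
        else invs Q n v)"
      using invs_coxeter_gen_comp[OF v r(1)] by blast
    have abs_mem: "\<bar>x\<bar> \<in> E \<longleftrightarrow> x \<in> E" for x
      using even_image_uminus[OF v, of x] E by (auto simp: abs_if)
    have "even i \<longleftrightarrow> v i \<in> E" "even j \<longleftrightarrow> v j \<in> E"
      using mem_even_image_iff[OF v] ij E by auto
    then have "even i \<longleftrightarrow> even j"
      using ij(3) r(2) abs_mem[of "v i"] abs_mem[of "v j"] by auto
    then have same: "\<not> odd_pairs \<bar>i\<bar> j" by (simp add: odd_pairs_def)
    \<comment> \<open>Adjacent positions have opposite parity, so a new descent would be a new odd
      inversion, and the odd inversions have not changed.\<close>
    have "coxeter_gen r (v k) < coxeter_gen r (v (k + 1))"
      if k: "0 \<le> k" "k < int n" "nat k \<notin> J" for k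
    proof (rule ccontr)
      assume "\<not> ?thesis"
      moreover have "coxeter_gen r (v k) \<noteq> coxeter_gen r (v (k + 1))"
        using hyperoct_eq_iff[OF hyperoct_comp[OF coxeter_gen_hyperoct[OF r(1)] v], of k "k + 1"]
        by simp
      ultimately have "(k, k + 1) \<in> invs odd_pairs n (coxeter_gen r \<circ> v)"
        using k by (auto simp: invs_def odd_pairs_def)
      then have "(k, k + 1) \<in> invs odd_pairs n v" using eq[of odd_pairs] same by simp
      then show False using inc[OF k] by (simp add: invs_def)
    qed
    then have "coxeter_gen r \<circ> v \<in> hyperoct_desc n J"
      using hyperoct_comp[OF coxeter_gen_hyperoct[OF r(1)] v] by (simp add: hyperoct_desc_iff)
    moreover have "even_image n (coxeter_gen r \<circ> v) = E"
      using closed E by (simp only: even_image_def image_comp[symmetric])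
    ultimately show ?thesis
      using eq[of odd_pairs] same by (simp add: weight_def cox_sign_gen_comp[OF v r(1)])
  qed
  have involution: "coxeter_gen r \<circ> (coxeter_gen r \<circ> v) = v" for v
    by (simp add: comp_assoc[symmetric] coxeter_gen_involution)
  have "(\<Sum>v\<in>?F. weight odd_pairs n v) = (\<Sum>v\<in>?F. - weight odd_pairs n v)"
    by (rule sum.reindex_bij_witness[of _ "\<lambda>v. coxeter_gen r \<circ> v" "\<lambda>v. coxeter_gen r \<circ> v"])
       (use step involution in \<open>auto simp del: mem_Collect_eq\<close>)
  then have "(\<Sum>v\<in>?F. weight odd_pairs n v) + (\<Sum>v\<in>?F. weight odd_pairs n v) = 0"
    by (simp add: sum_negf)
  then show ?thesis by simp
qed

lemma sum_weight_even_image: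
  "(\<Sum>v\<in>hyperoct_desc n J. weight odd_pairs n v * G (even_image n v)) =
     signed_sum n J * G {i. \<bar>i\<bar> \<le> int n \<and> even i}"
proof -
  let ?D = "hyperoct_desc n J" and ?Ev = "{i. \<bar>i\<bar> \<le> int n \<and> even i}"
  \<comment> \<open>Stated for all \<open>H\<close> because it is used twice: with \<open>G\<close>,
    and with the constant 1, which identifies the surviving fibre sum with
    \<open>signed_sum n J\<close>.\<close>
  have main: "(\<Sum>v\<in>?D. weight odd_pairs n v * H (even_image n v)) =
      (\<Sum>v | v \<in> ?D \<and> even_image n v = ?Ev. weight odd_pairs n v) * H ?Ev" for H
  proof -
    have "(\<Sum>v\<in>?D. weight odd_pairs n v * H (even_image n v)) =
        (\<Sum>E\<in>even_image n ` ?D. \<Sum>v | v \<in> ?D \<and> even_image n v = E. weight odd_pairs n v * H (even_image n v))"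
      by (rule sum.image_gen) (rule finite_hyperoct_desc)
    also have "\<dots> = (\<Sum>E\<in>even_image n ` ?D.
        if E = ?Ev then (\<Sum>v | v \<in> ?D \<and> even_image n v = ?Ev. weight odd_pairs n v) * H ?Ev else 0)"
    proof (rule sum.cong)
      fix E
      have "(\<Sum>v | v \<in> ?D \<and> even_image n v = E. weight odd_pairs n v * H (even_image n v)) =
          (\<Sum>v | v \<in> ?D \<and> even_image n v = E. weight odd_pairs n v) * H E"
        by (simp add: sum_distrib_right)
      then show "(\<Sum>v | v \<in> ?D \<and> even_image n v = E. weight odd_pairs n v * H (even_image n v)) =
          (if E = ?Ev then (\<Sum>v | v \<in> ?D \<and> even_image n v = ?Ev. weight odd_pairs n v) * H ?Ev else 0)"
        using even_image_fibre_sum_zero[of E n J] by simp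
    qed simp
    also have "\<dots> = (\<Sum>v | v \<in> ?D \<and> even_image n v = ?Ev. weight odd_pairs n v) * H ?Ev"
    proof (cases "?Ev \<in> even_image n ` ?D")
      case True
      then show ?thesis by (simp add: finite_hyperoct_desc)
    next
      case False
      then have "{v. v \<in> ?D \<and> even_image n v = ?Ev} = {}" by blast
      then have "(\<Sum>v | v \<in> ?D \<and> even_image n v = ?Ev. weight odd_pairs n v) = 0"
        by (simp only: sum.empty)
      then show ?thesis using False by (simp add: finite_hyperoct_desc)
    qed
    finally show ?thesis .
  qed
  show ?thesis using main[of G] main[of "\<lambda>_. 1"] by (simp add: signed_sum_def)
qed

section \<open>Factorization at the last descent\<close>

lemma hyperoct_desc_singleton_less:
  assumes u: "u \<in> hyperoct_desc n {m}" and "m \<le> n" "\<bar>i\<bar> \<le> int m" "\<bar>j\<bar> \<le> int m" "i < j"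
  shows "u i < u j"
proof (rule increasing_int_interval[where a = "- int m" and b = "int m" and x = u])
  fix k assume k: "- int m \<le> k" "k < int m"
  have inc: "u l < u (l + 1)" if "0 \<le> l" "l < int m" for l
    using u that \<open>m \<le> n\<close> by (auto simp: hyperoct_desc_iff)
  have minus: "u (- x) = - u x" for x
    using u hyperoct_minus by (auto simp: hyperoct_desc_iff)
  show "u k < u (k + 1)"
  proof (cases "0 \<le> k")
    case True
    then show ?thesis using inc k by simp
  next
    case False
    then show ?thesis using inc[of "- (k + 1)"] k minus[of "k + 1"] minus[of k] by simp
  qed
qed (use assms in auto)

text \<open>The first component is a value of \<open>v\<close> rather than a position of
  \<open>u \<circ> v\<close>, so that \<open>v\<close> enters only through the relation
  \<open>R\<close>.\<close>

definition cross_inversions :: "nat \<Rightarrow> nat \<Rightarrow> (int \<Rightarrow> int) \<Rightarrow> (int \<Rightarrow> int \<Rightarrow> bool) \<Rightarrow> (int \<times> int) set" where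
  "cross_inversions m n u R = {(x, j). \<bar>x\<bar> \<le> int m \<and> int m < j \<and> j \<le> int n \<and> R x j \<and> u j < u x}"

definition outer_inversions :: "nat \<Rightarrow> nat \<Rightarrow> (int \<Rightarrow> int) \<Rightarrow> (int \<Rightarrow> int \<Rightarrow> bool) \<Rightarrow> (int \<times> int) set" where
  "outer_inversions m n u Q = {(i, j). int m < \<bar>i\<bar> \<and> \<bar>i\<bar> < j \<and> j \<le> int n \<and> Q \<bar>i\<bar> j \<and> u j < u i}"

text \<open>On the block \<open>u\<close> is increasing, outside it \<open>v\<close> is the
  identity; this settles the unmixed pairs. The mixed ones are reindexed by \<open>x = v i\<close>,
  with \<open>R\<close> expressing the condition on \<open>i\<close> in terms of
  \<open>x\<close>.\<close>

lemma card_invs_comp: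
  assumes u: "u \<in> hyperoct_desc n {m}" and v: "v \<in> hyperoct m" and "m \<le> n"
    and R: "\<And>i j. \<bar>i\<bar> \<le> int m \<Longrightarrow> int m < j \<Longrightarrow> j \<le> int n \<Longrightarrow> R (v i) j \<longleftrightarrow> Q \<bar>i\<bar> j"
  shows "card (invs Q n (u \<circ> v)) =
    card (invs Q m v) + card (cross_inversions m n u R) + card (outer_inversions m n u Q)"
proof -
  let ?C = "{(i, j). \<bar>i\<bar> \<le> int m \<and> int m < j \<and> j \<le> int n \<and> Q \<bar>i\<bar> j \<and> u j < u (v i)}"
  let ?f = "\<lambda>(i, j). (v i, j) :: int \<times> int"
  have u_less: "u y < u x \<longleftrightarrow> y < x" if "\<bar>x\<bar> \<le> int m" "\<bar>y\<bar> \<le> int m" for x y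
    using hyperoct_desc_singleton_less[OF u \<open>m \<le> n\<close>, of x y]
      hyperoct_desc_singleton_less[OF u \<open>m \<le> n\<close>, of y x] that
    by (cases x y rule: linorder_cases) auto
  have fixed: "v x = x" if "int m < \<bar>x\<bar>" for x
    using hyperoct_fixed[OF v that] .
  have less: "u (v j) < u (v i) \<longleftrightarrow> v j < v i" if "\<bar>i\<bar> \<le> int m" "\<bar>j\<bar> \<le> int m" for i j
    using u_less that by (simp add: hyperoct_abs_le[OF v])
  have "p \<in> invs Q n (u \<circ> v) \<longleftrightarrow> p \<in> invs Q m v \<union> ?C \<union> outer_inversions m n u Q" for p
  proof -
    obtain i j where p: "p = (i, j)" by (cases p)
    consider "j \<le> int m" | "\<bar>i\<bar> \<le> int m" "int m < j" | "int m < \<bar>i\<bar>" "int m < j"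
      by linarith
    then show ?thesis
    proof cases
      case 1
      then show ?thesis
        using \<open>m \<le> n\<close> less[of i j] unfolding p invs_def outer_inversions_def by auto
    next
      case 2
      then show ?thesis
        using fixed[of j] unfolding p invs_def outer_inversions_def by auto
    next
      case 3
      then show ?thesis
        using fixed[of i] fixed[of j] unfolding p invs_def outer_inversions_def by auto
    qed
  qed
  then have split: "invs Q n (u \<circ> v) = invs Q m v \<union> ?C \<union> outer_inversions m n u Q"
    by blast
  have fin: "finite ?C" "finite (outer_inversions m n u Q)"
    by (rule finite_subset[of _ "{- int n..int n} \<times> {- int n..int n}"],
        use \<open>m \<le> n\<close> in \<open>auto simp: outer_inversions_def\<close>)+
  have "bij_betw ?f ?C (cross_inversions m n u R)"
    unfolding bij_betw_def
  proof
    show "inj_on ?f ?C" by (auto simp: inj_on_def hyperoct_eq_iff[OF v])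
    show "?f ` ?C = cross_inversions m n u R"
    proof (intro set_eqI iffI)
      fix p assume "p \<in> ?f ` ?C"
      then show "p \<in> cross_inversions m n u R"
        using R by (auto simp: cross_inversions_def hyperoct_abs_le[OF v])
    next
      fix p assume p: "p \<in> cross_inversions m n u R"
      obtain x j where xj: "p = (x, j)" by (cases p)
      define i where "i = inv v x"
      have x: "v i = x"
        unfolding i_def using v by (simp add: surj_f_inv_f[OF bij_is_surj[OF hyperoct_bij]])
      have "(i, j) \<in> ?C"
        using p R[of i j] hyperoct_abs_le[OF v, of i]
        by (auto simp: xj cross_inversions_def x)
      then show "p \<in> ?f ` ?C" using x by (force simp: xj image_iff)
    qed
  qed
  then have "card ?C = card (cross_inversions m n u R)" by (rule bij_betw_same_card)
  moreover have "card (invs Q m v \<union> ?C \<union> outer_inversions m n u Q) =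
      card (invs Q m v \<union> ?C) + card (outer_inversions m n u Q)"
    by (rule card_Un_disjoint) (use fin finite_invs[of Q m v] in \<open>auto simp: invs_def outer_inversions_def\<close>)
  moreover have "card (invs Q m v \<union> ?C) = card (invs Q m v) + card ?C"
    by (rule card_Un_disjoint) (use fin finite_invs[of Q m v] in \<open>auto simp: invs_def\<close>)
  ultimately show ?thesis by (simp add: split)
qed

text \<open>Without a filter the mixed term does not depend on \<open>v\<close>; comparison with
  \<open>v = id\<close>, which has no inversions, identifies the remaining terms with the inversions
  of \<open>u\<close>.\<close>

lemma cox_sign_comp:
  assumes u: "u \<in> hyperoct_desc n {m}" and v: "v \<in> hyperoct m" and "m \<le> n"
  shows "cox_sign n (u \<circ> v) = cox_sign m v * cox_sign n u"
proof -
  have "invs all_pairs m id = {}" by (auto simp: invs_def)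
  then have "card (invs all_pairs n (u \<circ> v)) = card (invs all_pairs m v) + card (invs all_pairs n u)"
    using card_invs_comp[OF u v \<open>m \<le> n\<close>, of all_pairs all_pairs]
      card_invs_comp[OF u hyperoct_id \<open>m \<le> n\<close>, of all_pairs all_pairs] by simp
  then show ?thesis by (simp only: cox_sign_def power_add)
qed

text \<open>The parity of a position up to \<open>m\<close> can be read off from
  \<open>even_image m v\<close>, so this set is all that the cofactor of \<open>v\<close> depends
  on. Its value at the even numbers comes from \<open>v = id\<close>.\<close>

lemma weight_comp:
  assumes u: "u \<in> hyperoct_desc n {m}" and "m \<le> n"
  obtains G where "\<And>v. v \<in> hyperoct m \<Longrightarrow>
      weight odd_pairs n (u \<circ> v) = weight odd_pairs m v * G (even_image m v)"
    "G {i. \<bar>i\<bar> \<le> int m \<and> even i} = weight odd_pairs n u"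
proof -
  define G where "G E = cox_sign n u *
    monom 1 (card (cross_inversions m n u (\<lambda>x j. x \<in> E \<longleftrightarrow> odd j)) + card (outer_inversions m n u odd_pairs))"
    for E
  have G: "weight odd_pairs n (u \<circ> v) = weight odd_pairs m v * G (even_image m v)"
    if v: "v \<in> hyperoct m" for v
  proof -
    have "card (invs odd_pairs n (u \<circ> v)) = card (invs odd_pairs m v) +
        card (cross_inversions m n u (\<lambda>x j. x \<in> even_image m v \<longleftrightarrow> odd j)) +
        card (outer_inversions m n u odd_pairs)"
      by (rule card_invs_comp[OF u v \<open>m \<le> n\<close>])
         (simp add: mem_even_image_iff[OF v] odd_pairs_def)
    then have "(monom 1 (card (invs odd_pairs n (u \<circ> v))) :: int poly) =
        monom 1 (card (invs odd_pairs m v)) *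
        monom 1 (card (cross_inversions m n u (\<lambda>x j. x \<in> even_image m v \<longleftrightarrow> odd j)) +
          card (outer_inversions m n u odd_pairs))"
      by (simp add: mult_monom add.assoc)
    then show ?thesis
      unfolding weight_def G_def cox_sign_comp[OF u v \<open>m \<le> n\<close>] by (simp only: mult_ac)
  qed
  have "invs Q m id = {}" for Q by (auto simp: invs_def)
  then have "weight odd_pairs m id = 1"
    by (simp add: weight_def cox_sign_def)
  moreover have "even_image m id = {i. \<bar>i\<bar> \<le> int m \<and> even i}"
    by (simp add: even_image_def)
  ultimately have "G {i. \<bar>i\<bar> \<le> int m \<and> even i} = weight odd_pairs n u"
    using G[OF hyperoct_id] by simp
  then show ?thesis using that[of G] G by blast
qed

text \<open>\<open>v\<close> is the rank function of the values of \<open>w\<close> on \<open>{-m..m}\<close>, shifted so that \<open>0\<close> has rank \<open>0\<close>.\<close>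
lemma hyperoct_sort_prefix:
  assumes w: "w \<in> hyperoct n" and "m \<le> n"
  obtains v where "v \<in> hyperoct m"
    "\<And>i j. \<bar>i\<bar> \<le> int m \<Longrightarrow> \<bar>j\<bar> \<le> int m \<Longrightarrow> v i < v j \<longleftrightarrow> w i < w j"
proof -
  define S where "S = {- int m..int m}"
  define below where "below i = {k \<in> S. w k \<le> w i}" for i
  define v where "v i = (if i \<in> S then int (card (below i)) - (int m + 1) else i)" for i
  have "finite S" by (simp add: S_def)
  then have fin: "finite S" "finite (below i)" for i by (simp_all add: below_def)
  have card_S: "card S = 2 * m + 1" by (simp add: S_def)
  have less: "v i < v j \<longleftrightarrow> w i < w j" if "i \<in> S" "j \<in> S" for i j
  proof -
    have mono: "card (below i) < card (below j)" if "w i < w j" "j \<in> S" for i j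
    proof (rule psubset_card_mono)
      have "j \<in> below j" "j \<notin> below i" using that by (auto simp: below_def)
      moreover have "below i \<subseteq> below j" using that by (auto simp: below_def)
      ultimately show "below i \<subset> below j" by blast
    qed (rule fin)
    have "w i = w j \<longrightarrow> below i = below j" by (simp add: below_def)
    then show ?thesis
      using mono[of i j] mono[of j i] that
      by (cases "w i" "w j" rule: linorder_cases) (auto simp: v_def)
  qed
  have in_S: "v i \<in> S" if "i \<in> S" for i
  proof -
    have "card (below i) \<le> 2 * m + 1"
      using card_mono[OF fin(1), of "below i"] card_S by (simp add: below_def)
    moreover have "card (below i) > 0"
      using that fin(2)[of i] by (auto simp: card_gt_0_iff below_def)
    ultimately show ?thesis using that by (auto simp: v_def S_def)
  qed
  have inj: "inj_on v S"
  proof (rule inj_onI)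
    fix i j assume ij: "i \<in> S" "j \<in> S" "v i = v j"
    have "\<not> w i < w j" "\<not> w j < w i"
      using less[OF ij(1,2)] less[OF ij(2,1)] ij(3) by linarith+
    then have "w i = w j" by linarith
    then show "i = j" using hyperoct_eq_iff[OF w] by blast
  qed
  have "bij_betw v S S"
    unfolding bij_betw_def using inj in_S endo_inj_surj[OF fin(1), of v] by blast
  then have perm: "v permutes S"
    by (rule bij_imp_permutes) (simp add: v_def)
  have minus: "v (- i) = - v i" for i
  proof (cases "i \<in> S")
    case True
    \<comment> \<open>Negation exchanges the ranks counted from below and from above. The two ranks
      of \<open>i\<close> both count \<open>i\<close>, so they add up to
      \<open>card S + 1 = 2 * m + 2\<close>.\<close>
    let ?above = "{k \<in> S. w i \<le> w k}"
    have "below (- i) = uminus ` ?above"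
    proof (intro set_eqI iffI)
      fix k assume "k \<in> below (- i)"
      then have "- k \<in> ?above" by (auto simp: below_def S_def hyperoct_minus[OF w])
      then show "k \<in> uminus ` ?above" by (metis imageI minus_minus)
    qed (auto simp: below_def S_def hyperoct_minus[OF w])
    then have "card (below (- i)) = card ?above" by (simp add: card_image)
    moreover have "card (below i \<union> ?above) + card (below i \<inter> ?above) = card (below i) + card ?above"
      using card_Un_Int[OF fin(2)[of i], of ?above] fin(1) by simp
    moreover have "below i \<union> ?above = S" by (auto simp: below_def)
    moreover have "below i \<inter> ?above = {i}"
    proof -
      have "k = i" if "w k \<le> w i" "w i \<le> w k" for k
        using that hyperoct_eq_iff[OF w, of k i] by simp
      then show ?thesis using True by (auto simp: below_def)
    qed
    ultimately have "card (below (- i)) + card (below i) = 2 * m + 2"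
      using card_S by simp
    moreover have "- i \<in> S" using True by (auto simp: S_def)
    ultimately show ?thesis using True by (simp add: v_def)
  next
    case False
    moreover have "- i \<notin> S" using False by (auto simp: S_def)
    ultimately show ?thesis by (simp add: v_def)
  qed
  have "v \<in> hyperoct m" using perm minus by (auto intro: hyperoctI simp: S_def)
  moreover have "v i < v j \<longleftrightarrow> w i < w j" if "\<bar>i\<bar> \<le> int m" "\<bar>j\<bar> \<le> int m" for i j
    by (rule less) (use that in \<open>auto simp: S_def\<close>)
  ultimately show ?thesis using that[of v] by blast
qed

text \<open>A parabolic decomposition. Existence: \<open>v\<close> sorts the values of
  \<open>w\<close> on the block. Uniqueness: two choices of \<open>u\<close> differ by an element of
  \<open>hyperoct m\<close> that must be increasing, hence is the identity.\<close>

lemma hyperoct_desc_insert_bij: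
  assumes "m < n" and J: "J \<subseteq> {0..<m}"
  shows "bij_betw (\<lambda>(u, v). u \<circ> v) (hyperoct_desc n {m} \<times> hyperoct_desc m J)
    (hyperoct_desc n (insert m J))"
  unfolding bij_betw_def
proof
  have comp_inv: "inv f \<circ> f = id" "f \<circ> inv f = id" if "f \<in> hyperoct k" for f k
    using hyperoct_bij[OF that] by (auto simp: bij_def surj_iff)
  show "inj_on (\<lambda>(u, v). u \<circ> v) (hyperoct_desc n {m} \<times> hyperoct_desc m J)"
  proof (rule inj_onI, clarify)
    fix u v u' v'
    assume u: "u \<in> hyperoct_desc n {m}" and u': "u' \<in> hyperoct_desc n {m}"
      and v_desc: "v \<in> hyperoct_desc m J" and v'_desc: "v' \<in> hyperoct_desc m J"
      and eq: "u \<circ> v = u' \<circ> v'"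
    have v: "v \<in> hyperoct m" and v': "v' \<in> hyperoct m" and u'_hyp: "u' \<in> hyperoct n"
      using v_desc v'_desc u' by (auto simp: hyperoct_desc_iff)
    define x where "x = v' \<circ> inv v"
    have x: "x \<in> hyperoct m" unfolding x_def by (intro hyperoct_comp hyperoct_inv v v')
    have "u = u \<circ> (v \<circ> inv v)" using comp_inv[OF v] by simp
    also have "\<dots> = u' \<circ> x" using eq unfolding x_def by (simp add: comp_assoc[symmetric])
    finally have ux: "u = u' \<circ> x" .
    have "x i < x (i + 1)" if "0 \<le> i" "i < int m" for i
    proof (rule ccontr)
      assume "\<not> x i < x (i + 1)"
      moreover have "\<bar>x i\<bar> \<le> int m" "\<bar>x (i + 1)\<bar> \<le> int m"
        using that by (simp_all add: hyperoct_abs_le[OF x])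
      ultimately have "u' (x (i + 1)) \<le> u' (x i)"
        using hyperoct_desc_singleton_less[OF u', of "x (i + 1)" "x i"] \<open>m < n\<close>
        by (cases "x i = x (i + 1)") auto
      moreover have "u i < u (i + 1)"
        using hyperoct_desc_singleton_less[OF u, of i "i + 1"] \<open>m < n\<close> that by auto
      ultimately show False using ux by simp
    qed
    then have "x = id" by (rule hyperoct_increasing_eq_id[OF x])
    then have "u = u'" using ux by simp
    moreover have "v = v'"
    proof
      fix i
      have "u' (v i) = u' (v' i)" using eq \<open>u = u'\<close> by (metis comp_apply)
      then show "v i = v' i" using hyperoct_eq_iff[OF u'_hyp] by blast
    qed
    ultimately show "u = u' \<and> v = v'" by blast
  qed
  show "(\<lambda>(u, v). u \<circ> v) ` (hyperoct_desc n {m} \<times> hyperoct_desc m J) = hyperoct_desc n (insert m J)"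
  proof (intro set_eqI iffI)
    fix w assume "w \<in> (\<lambda>(u, v). u \<circ> v) ` (hyperoct_desc n {m} \<times> hyperoct_desc m J)"
    then obtain u v where u: "u \<in> hyperoct_desc n {m}" and v: "v \<in> hyperoct_desc m J"
      and w: "w = u \<circ> v" by auto
    have hyp: "u \<in> hyperoct n" "v \<in> hyperoct m" using u v by (auto simp: hyperoct_desc_iff)
    have "w i < w (i + 1)" if i: "0 \<le> i" "i < int n" "nat i \<notin> insert m J" for i
    proof (cases "i < int m")
      case True
      then have "v i < v (i + 1)" using v i by (auto simp: hyperoct_desc_iff)
      then show ?thesis
        unfolding w using True i \<open>m < n\<close>
        by (auto intro!: hyperoct_desc_singleton_less[OF u] simp: hyperoct_abs_le[OF hyp(2)])
    next
      case False
      moreover have "i \<noteq> int m" using i by auto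
      ultimately have "v i = i" "v (i + 1) = i + 1"
        using hyperoct_fixed[OF hyp(2)] by auto
      then show ?thesis using u i by (auto simp: w hyperoct_desc_iff)
    qed
    moreover have "w \<in> hyperoct n"
      unfolding w using hyp \<open>m < n\<close> by (intro hyperoct_comp) (auto intro: hyperoct_mono[of m])
    ultimately show "w \<in> hyperoct_desc n (insert m J)" by (simp add: hyperoct_desc_iff)
  next
    fix w assume "w \<in> hyperoct_desc n (insert m J)"
    then have w: "w \<in> hyperoct n"
      and inc: "\<And>i. 0 \<le> i \<Longrightarrow> i < int n \<Longrightarrow> nat i \<notin> insert m J \<Longrightarrow> w i < w (i + 1)"
      by (auto simp: hyperoct_desc_iff)
    obtain v where v: "v \<in> hyperoct m"
      and less: "\<And>i j. \<bar>i\<bar> \<le> int m \<Longrightarrow> \<bar>j\<bar> \<le> int m \<Longrightarrow> v i < v j \<longleftrightarrow> w i < w j"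
      using hyperoct_sort_prefix[OF w, of m] \<open>m < n\<close> by auto
    define u where "u = w \<circ> inv v"
    have v_inv: "v (inv v x) = x" for x
      using comp_inv(2)[OF v] by (metis comp_apply id_apply)
    have inv_le: "\<bar>inv v x\<bar> \<le> int m \<longleftrightarrow> \<bar>x\<bar> \<le> int m" for x
      by (rule hyperoct_abs_le[OF hyperoct_inv[OF v]])
    have "v \<in> hyperoct_desc m J"
      unfolding hyperoct_desc_iff
    proof (intro conjI allI impI v)
      fix i assume i: "0 \<le> i" "i < int m" "nat i \<notin> J"
      then have "w i < w (i + 1)" using inc[of i] \<open>m < n\<close> by auto
      then show "v i < v (i + 1)" using less[of i "i + 1"] i by auto
    qed
    moreover have "u \<in> hyperoct_desc n {m}"
      unfolding hyperoct_desc_iff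
    proof (intro conjI allI impI)
      show "u \<in> hyperoct n"
        unfolding u_def using w hyperoct_inv[OF v] \<open>m < n\<close>
        by (intro hyperoct_comp) (auto intro: hyperoct_mono[of m])
      fix i assume i: "0 \<le> i" "i < int n" "nat i \<notin> {m}"
      show "u i < u (i + 1)"
      proof (cases "i < int m")
        case True
        then show ?thesis
          using less[of "inv v i" "inv v (i + 1)"] i by (simp add: u_def inv_le v_inv)
      next
        case False
        then have "i > int m" using i by auto
        then have "inv v i = i" "inv v (i + 1) = i + 1"
          using hyperoct_fixed[OF hyperoct_inv[OF v]] by auto
        moreover have "m < nat i" using \<open>i > int m\<close> by simp
        then have "nat i \<notin> insert m J" using J by auto
        ultimately show ?thesis using inc i by (simp add: u_def)
      qed
    qed
    moreover have "w = u \<circ> v"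
      unfolding u_def using comp_inv(1)[OF v] by (simp add: comp_assoc)
    ultimately show "w \<in> (\<lambda>(u, v). u \<circ> v) ` (hyperoct_desc n {m} \<times> hyperoct_desc m J)"
      by (force simp: image_iff)
  qed
qed

lemma signed_sum_insert:
  assumes "m < n" and "J \<subseteq> {0..<m}"
  shows "signed_sum n (insert m J) = signed_sum n {m} * signed_sum m J"
proof -
  have "signed_sum n (insert m J) =
      (\<Sum>(u, v)\<in>hyperoct_desc n {m} \<times> hyperoct_desc m J. weight odd_pairs n (u \<circ> v))"
    unfolding signed_sum_def
    by (subst sum.reindex_bij_betw[OF hyperoct_desc_insert_bij[OF assms], symmetric])
       (simp only: case_prod_unfold)
  also have "\<dots> = (\<Sum>u\<in>hyperoct_desc n {m}. \<Sum>v\<in>hyperoct_desc m J. weight odd_pairs n (u \<circ> v))"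
    by (rule sum.cartesian_product[symmetric])
  also have "\<dots> = (\<Sum>u\<in>hyperoct_desc n {m}. weight odd_pairs n u * signed_sum m J)"
  proof (rule sum.cong)
    fix u assume u: "u \<in> hyperoct_desc n {m}"
    obtain G where G: "\<And>v. v \<in> hyperoct m \<Longrightarrow>
        weight odd_pairs n (u \<circ> v) = weight odd_pairs m v * G (even_image m v)"
      "G {i. \<bar>i\<bar> \<le> int m \<and> even i} = weight odd_pairs n u"
      using weight_comp[OF u] \<open>m < n\<close> by (metis less_imp_le)
    have "(\<Sum>v\<in>hyperoct_desc m J. weight odd_pairs n (u \<circ> v)) =
        (\<Sum>v\<in>hyperoct_desc m J. weight odd_pairs m v * G (even_image m v))"
      by (rule sum.cong) (auto simp: G hyperoct_desc_iff)
    also have "\<dots> = weight odd_pairs n u * signed_sum m J"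
      by (subst sum_weight_even_image) (simp only: G(2) mult.commute)
    finally show "(\<Sum>v\<in>hyperoct_desc m J. weight odd_pairs n (u \<circ> v)) =
        weight odd_pairs n u * signed_sum m J" .
  qed simp
  also have "\<dots> = signed_sum n {m} * signed_sum m J"
    by (simp add: signed_sum_def sum_distrib_right)
  finally show ?thesis .
qed

section \<open>Inserting the extreme value\<close>

text \<open>
  \<open>u \<circ> insertion N p s\<close> is obtained from \<open>u \<in> hyperoct N\<close> by inserting the value \<open>s * (N + 1)\<close>
  at position \<open>p\<close>.
\<close>
definition insertion :: "nat \<Rightarrow> nat \<Rightarrow> int \<Rightarrow> int \<Rightarrow> int" where
  "insertion N p s i =
     (if \<bar>i\<bar> = int p then sgn i * s * (int N + 1)
      else if int p < \<bar>i\<bar> \<and> \<bar>i\<bar> \<le> int N + 1 then i - sgn i else i)"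

lemma insertion_hyperoct:
  assumes p: "1 \<le> p" "p \<le> Suc N" and s: "\<bar>s\<bar> = 1"
  shows "insertion N p s \<in> hyperoct (Suc N)"
proof (rule hyperoctI)
  let ?f = "insertion N p s" and ?S = "{- int (Suc N)..int (Suc N)}"
  show minus: "?f (- i) = - ?f i" for i
    by (simp add: insertion_def)
  have abs: "\<bar>?f i\<bar> = (if \<bar>i\<bar> = int p then int N + 1
      else if int p < \<bar>i\<bar> \<and> \<bar>i\<bar> \<le> int N + 1 then \<bar>i\<bar> - 1 else \<bar>i\<bar>)" for i
    using p s by (auto simp: insertion_def abs_mult sgn_if)
  have inj: "inj_on ?f ?S"
  proof (rule inj_onI)
    fix i j assume ij: "i \<in> ?S" "j \<in> ?S" "?f i = ?f j"
    then have "\<bar>?f i\<bar> = \<bar>?f j\<bar>" "\<bar>i\<bar> \<le> int N + 1" "\<bar>j\<bar> \<le> int N + 1" by auto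
    then have "\<bar>i\<bar> = \<bar>j\<bar>" by (auto simp: abs split: if_splits)
    then consider "i = j" | "j = - i" by linarith
    then show "i = j"
    proof cases
      case 2
      then have "\<bar>?f i\<bar> = 0" using ij(3) minus[of i] by simp
      then have "i = 0" using p by (auto simp: abs split: if_splits)
      then show ?thesis using 2 by simp
    qed
  qed
  have "?f ` ?S \<subseteq> ?S"
  proof clarify
    fix i assume "i \<in> ?S"
    then have "\<bar>i\<bar> \<le> int N + 1" by auto
    then have "\<bar>?f i\<bar> \<le> int N + 1" by (auto simp: abs)
    then show "?f i \<in> ?S" by auto
  qed
  then have "bij_betw ?f ?S ?S"
    using inj endo_inj_surj[of ?S ?f] by (simp add: bij_betw_def)
  then show "?f permutes ?S"
    by (rule bij_imp_permutes) (use p in \<open>auto simp: insertion_def\<close>)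
qed

lemma hyperoct_Suc_fixed:
  assumes w: "w \<in> hyperoct (Suc N)" and "w (int N + 1) = int N + 1"
  shows "w \<in> hyperoct N"
proof (rule hyperoctI)
  show "w (- i) = - w i" for i by (rule hyperoct_minus[OF w])
  show "w permutes {- int N..int N}"
  proof (rule permutes_superset[OF hyperoct_permutes[OF w]])
    fix x assume "x \<in> {- int (Suc N)..int (Suc N)} - {- int N..int N}"
    then have "x = int N + 1 \<or> x = - (int N + 1)" by auto
    then show "w x = x" using assms(2) hyperoct_minus[OF w, of "int N + 1"] by auto
  qed
qed

lemma hyperoct_insertion_value:
  assumes "u \<in> hyperoct N" "1 \<le> p" "\<bar>s\<bar> = 1"
  shows "(u \<circ> insertion N p s) (int p) = s * (int N + 1)"
proof -
  have "s = 1 \<or> s = - 1" using assms(3) by linarith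
  moreover have "u (int N + 1) = int N + 1" "u (- (int N + 1)) = - (int N + 1)"
    using hyperoct_fixed[OF assms(1)] by simp_all
  ultimately show ?thesis using assms(2) by (auto simp: insertion_def)
qed

lemma hyperoct_insertion_image:
  assumes p: "1 \<le> p" "p \<le> Suc N" and s: "\<bar>s\<bar> = 1"
  shows "(\<lambda>u. u \<circ> insertion N p s) ` hyperoct N = {w \<in> hyperoct (Suc N). w (int p) = s * (int N + 1)}"
proof (intro set_eqI iffI)
  fix w assume "w \<in> (\<lambda>u. u \<circ> insertion N p s) ` hyperoct N"
  then obtain u where u: "u \<in> hyperoct N" "w = u \<circ> insertion N p s" by auto
  have "w \<in> hyperoct (Suc N)"
    unfolding u(2)
    by (rule hyperoct_comp[OF hyperoct_mono[OF _ u(1)] insertion_hyperoct[OF assms]]) simp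
  moreover have "w (int p) = s * (int N + 1)"
    unfolding u(2) by (rule hyperoct_insertion_value[OF u(1) p(1) s])
  ultimately show "w \<in> {w \<in> hyperoct (Suc N). w (int p) = s * (int N + 1)}" by blast
next
  let ?f = "insertion N p s"
  note f = insertion_hyperoct[OF assms]
  fix w assume "w \<in> {w \<in> hyperoct (Suc N). w (int p) = s * (int N + 1)}"
  then have w: "w \<in> hyperoct (Suc N)" "w (int p) = s * (int N + 1)" by auto
  define u where "u = w \<circ> inv ?f"
  have u: "u \<in> hyperoct (Suc N)" unfolding u_def by (intro hyperoct_comp hyperoct_inv w f)
  have inv: "inv ?f (?f x) = x" for x using bij_is_inj[OF hyperoct_bij[OF f]] by simp
  have "?f (int p) = s * (int N + 1)" using p by (simp add: insertion_def)
  then have "u (s * (int N + 1)) = s * (int N + 1)"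
    using inv[of "int p"] w(2) by (simp add: u_def)
  moreover have "s = 1 \<or> s = - 1" using s by linarith
  ultimately have "u (int N + 1) = int N + 1"
    using hyperoct_minus[OF u, of "int N + 1"] by auto
  then have "u \<in> hyperoct N" by (rule hyperoct_Suc_fixed[OF u])
  moreover have "w = u \<circ> ?f" by (simp add: u_def fun_eq_iff inv)
  ultimately show "w \<in> (\<lambda>u. u \<circ> ?f) ` hyperoct N" by blast
qed

lemma insertion_comp_inj:
  assumes "1 \<le> p" "p \<le> Suc N" "\<bar>s\<bar> = 1"
  shows "inj_on (\<lambda>u. u \<circ> insertion N p s) A"
proof (rule inj_onI)
  fix u v assume eq: "u \<circ> insertion N p s = v \<circ> insertion N p s"
  have "surj (insertion N p s)"
    using hyperoct_bij[OF insertion_hyperoct[OF assms]] by (rule bij_is_surj)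
  then show "u = v" using eq by (metis surj_fun_eq comp_apply fun_eq_iff surj_f_inv_f)
qed

text \<open>A largest entry can only be followed by a descent, a smallest one only preceded by it;
  this dictates \<open>q\<close>. Either way the entries of \<open>u\<close> at \<open>p - 1\<close>
  and \<open>p\<close> become separated, so \<open>u\<close> may descend there.\<close>

lemma hyperoct_desc_insertion_iff:
  assumes u: "u \<in> hyperoct N" and p: "1 \<le> p" "p \<le> Suc N" and s: "\<bar>s\<bar> = 1"
    and q: "q = (if s = 1 then p else p - 1)"
  shows "u \<circ> insertion N p s \<in> hyperoct_desc (Suc N) {q} \<longleftrightarrow> u \<in> hyperoct_desc N {p - 1}"
proof -
  let ?w = "u \<circ> insertion N p s"
  have w_hyp: "?w \<in> hyperoct (Suc N)"
    using hyperoct_insertion_image[OF p s] u by blast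
  have w: "?w i = (if i < int p then u i else if i = int p then s * (int N + 1) else u (i - 1))"
    if "0 \<le> i" "i \<le> int N + 1" for i
  proof (cases "i = int p")
    case True
    then show ?thesis using hyperoct_insertion_value[OF u p(1) s] by simp
  next
    case False
    then show ?thesis using that p by (simp add: insertion_def)
  qed
  have bound: "- (int N + 1) < u i" "u i < int N + 1" if "\<bar>i\<bar> \<le> int N" for i
    using that hyperoct_abs_le[OF u, of i] by auto
  have s': "s = 1 \<or> s = - 1" using s by linarith
  have "(\<forall>i. 0 \<le> i \<longrightarrow> i < int (Suc N) \<longrightarrow> nat i \<notin> {q} \<longrightarrow> ?w i < ?w (i + 1)) \<longleftrightarrow>
      (\<forall>i. 0 \<le> i \<longrightarrow> i < int N \<longrightarrow> nat i \<notin> {p - 1} \<longrightarrow> u i < u (i + 1))" (is "?L \<longleftrightarrow> ?R")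
  proof
    assume L: ?L
    show ?R
    proof (intro allI impI)
      fix i assume i: "0 \<le> i" "i < int N" "nat i \<notin> {p - 1}"
      then have ne: "i \<noteq> int p - 1" using p by auto
      show "u i < u (i + 1)"
      proof (cases "i < int p")
        case True
        then have "i + 1 < int p" using ne by simp
        moreover have "nat i \<notin> {q}" using calculation p i by (auto simp: q)
        ultimately show ?thesis using L[rule_format, of i] i w[of i] w[of "i + 1"] by simp
      next
        case False
        have "nat (i + 1) \<notin> {q}" using False p i by (auto simp: q)
        then show ?thesis
          using L[rule_format, of "i + 1"] i False w[of "i + 1"] w[of "i + 2"] by (simp add: algebra_simps)
      qed
    qed
  next
    assume R: ?R
    show ?L
    proof (intro allI impI)
      fix i assume i: "0 \<le> i" "i < int (Suc N)" "nat i \<notin> {q}"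
      consider "i + 1 < int p" | "i + 1 = int p" | "i = int p" | "i > int p" by linarith
      then show "?w i < ?w (i + 1)"
      proof cases
        case 1
        then have "nat i \<notin> {p - 1}" using i by auto
        then show ?thesis using R[rule_format, of i] 1 i p w[of i] w[of "i + 1"] by simp
      next
        case 2
        then have "s = 1" using i s' p by (auto simp: q split: if_splits)
        then show ?thesis using 2 i w[of i] w[of "i + 1"] bound(2)[of i] by simp
      next
        case 3
        then have "s = - 1" using i s' p by (auto simp: q split: if_splits)
        then show ?thesis using 3 i w[of i] w[of "i + 1"] bound(1)[of i] by simp
      next
        case 4
        then have "nat (i - 1) \<notin> {p - 1}" using i p by auto
        then show ?thesis using R[rule_format, of "i - 1"] 4 i p w[of i] w[of "i + 1"] by simp
      qed
    qed
  qed
  then show ?thesis using w_hyp u unfolding hyperoct_desc_iff by blast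
qed

lemma hyperoct_desc_insertion_image:
  assumes p: "1 \<le> p" "p \<le> Suc N" and s: "\<bar>s\<bar> = 1" and q: "q = (if s = 1 then p else p - 1)"
  shows "{w \<in> hyperoct_desc (Suc N) {q}. w (int p) = s * (int N + 1)} =
    (\<lambda>u. u \<circ> insertion N p s) ` hyperoct_desc N {p - 1}"
proof -
  have sub: "hyperoct_desc k J \<subseteq> hyperoct k" for k J by (auto simp: hyperoct_desc_def)
  have "{w \<in> hyperoct_desc (Suc N) {q}. w (int p) = s * (int N + 1)} =
      (\<lambda>u. u \<circ> insertion N p s) ` hyperoct N \<inter> hyperoct_desc (Suc N) {q}"
    unfolding hyperoct_insertion_image[OF p s] using sub by blast
  also have "\<dots> = (\<lambda>u. u \<circ> insertion N p s) ` hyperoct_desc N {p - 1}"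
    using hyperoct_desc_insertion_iff[OF _ assms] sub by blast
  finally show ?thesis .
qed

lemma hyperoct_desc_last_fixed:
  assumes "m \<le> N"
  shows "{w \<in> hyperoct_desc (Suc N) {m}. w (int N + 1) = int N + 1} = hyperoct_desc N {m}"
proof (intro set_eqI iffI)
  fix w assume "w \<in> {w \<in> hyperoct_desc (Suc N) {m}. w (int N + 1) = int N + 1}"
  then show "w \<in> hyperoct_desc N {m}"
    using hyperoct_Suc_fixed[of w N] by (auto simp: hyperoct_desc_iff)
next
  fix w assume w: "w \<in> hyperoct_desc N {m}"
  then have hyp: "w \<in> hyperoct N" by (simp add: hyperoct_desc_iff)
  have top: "w (int N + 1) = int N + 1" using hyperoct_fixed[OF hyp] by simp
  have "w i < w (i + 1)" if "0 \<le> i" "i < int (Suc N)" "nat i \<notin> {m}" for i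
  proof (cases "i = int N")
    case True
    then show ?thesis using top hyperoct_abs_le[OF hyp, of i] by simp
  next
    case False
    then show ?thesis using w that by (simp add: hyperoct_desc_iff)
  qed
  then show "w \<in> {w \<in> hyperoct_desc (Suc N) {m}. w (int N + 1) = int N + 1}"
    using top hyperoct_mono[OF _ hyp, of "Suc N"] by (simp add: hyperoct_desc_iff)
qed

text \<open>At a positive position, \<open>N + 1\<close> must come last or start a descent. At a
  negative one, it puts \<open>- (N + 1)\<close> at the opposite position, which must end a
  descent.\<close>

lemma hyperoct_desc_max_position:
  assumes w: "w \<in> hyperoct_desc (Suc N) {m}" and "m \<le> N"
  shows "w (int N + 1) = int N + 1 \<or> (1 \<le> m \<and> w (int m) = int N + 1) \<or> w (int m + 1) = - (int N + 1)"
proof -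
  have hyp: "w \<in> hyperoct (Suc N)"
    and inc: "\<And>i. 0 \<le> i \<Longrightarrow> i < int N + 1 \<Longrightarrow> i \<noteq> int m \<Longrightarrow> w i < w (i + 1)"
    using w by (auto simp: hyperoct_desc_iff)
  define x where "x = inv w (int N + 1)"
  have x: "w x = int N + 1"
    unfolding x_def using hyp by (simp add: surj_f_inv_f[OF bij_is_surj[OF hyperoct_bij]])
  have x_le: "\<bar>x\<bar> \<le> int N + 1" using hyperoct_abs_le[OF hyp, of x] x by simp
  have bound: "\<bar>w i\<bar> \<le> int N + 1" if "\<bar>i\<bar> \<le> int N + 1" for i
    using hyperoct_abs_le[OF hyp, of i] that by simp
  have "x \<noteq> 0" using x hyperoct_zero[OF hyp] by auto
  show ?thesis
  proof (cases "x > 0")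
    case True
    have "x = int N + 1 \<or> x = int m"
    proof (rule ccontr)
      assume x_ne: "\<not> (x = int N + 1 \<or> x = int m)"
      then have "w x < w (x + 1)" using inc[of x] True x_le by auto
      then show False using bound[of "x + 1"] x x_le True x_ne by auto
    qed
    then show ?thesis using x True by auto
  next
    case False
    define y where "y = - x"
    have y: "y > 0" "w y = - (int N + 1)" "y \<le> int N + 1"
      using False \<open>x \<noteq> 0\<close> x x_le hyperoct_minus[OF hyp, of x] by (auto simp: y_def)
    have "y - 1 = int m"
    proof (rule ccontr)
      assume "y - 1 \<noteq> int m"
      then have "w (y - 1) < w y" using inc[of "y - 1"] y by auto
      then show False using bound[of "y - 1"] y by auto
    qed
    then have "y = int m + 1" by simp
    then show ?thesis using y(2) by simp
  qed
qed

lemma sum_hyperoct_desc_Suc: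
  assumes "m \<le> N"
  shows "(\<Sum>w\<in>hyperoct_desc (Suc N) {m}. F w) =
    (\<Sum>u\<in>hyperoct_desc N {m}. F u) +
    (if m = 0 then 0 else \<Sum>u\<in>hyperoct_desc N {m - 1}. F (u \<circ> insertion N m 1)) +
    (\<Sum>u\<in>hyperoct_desc N {m}. F (u \<circ> insertion N (Suc m) (- 1)))"
proof -
  let ?D = "hyperoct_desc (Suc N) {m}"
  let ?A = "{w \<in> ?D. w (int N + 1) = int N + 1}"
  let ?B = "{w \<in> ?D. 1 \<le> m \<and> w (int m) = int N + 1}"
  let ?C = "{w \<in> ?D. w (int m + 1) = - (int N + 1)}"
  have hyp: "w \<in> hyperoct (Suc N)" if "w \<in> ?D" for w using that by (simp add: hyperoct_desc_iff)
  have split: "?D = ?A \<union> ?B \<union> ?C"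
    using hyperoct_desc_max_position[OF _ assms] by blast
  have fin: "finite ?A" "finite ?B" "finite ?C" by (simp_all add: finite_hyperoct_desc)
  have "?A \<inter> ?B = {}"
  proof -
    have False if "w \<in> ?A" "w \<in> ?B" for w
      using that hyperoct_eq_iff[OF hyp, of w "int N + 1" "int m"] assms by auto
    then show ?thesis by blast
  qed
  moreover have "(?A \<union> ?B) \<inter> ?C = {}"
  proof -
    have False if "w \<in> ?A \<union> ?B" "w \<in> ?C" for w
      using that hyperoct_abs_eq_iff[OF hyp, of w "int m" "int m + 1"]
        hyperoct_eq_iff[OF hyp, of w "int N + 1" "int m + 1"]
        hyperoct_minus[OF hyp, of w "int N + 1"] hyperoct_eq_iff[OF hyp, of w "- (int N + 1)" "int m + 1"]
      by auto
    then show ?thesis by blast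
  qed
  ultimately have "(\<Sum>w\<in>?D. F w) = (\<Sum>w\<in>?A. F w) + (\<Sum>w\<in>?B. F w) + (\<Sum>w\<in>?C. F w)"
    using fin by (subst split, subst sum.union_disjoint) (auto simp: sum.union_disjoint)
  moreover have "?A = hyperoct_desc N {m}" by (rule hyperoct_desc_last_fixed[OF assms])
  moreover have "(\<Sum>w\<in>?B. F w) =
      (if m = 0 then 0 else \<Sum>u\<in>hyperoct_desc N {m - 1}. F (u \<circ> insertion N m 1))"
  proof (cases "m = 0")
    case False
    then have "?B = (\<lambda>u. u \<circ> insertion N m 1) ` hyperoct_desc N {m - 1}"
      using hyperoct_desc_insertion_image[of m N 1 m] assms by simp
    then show ?thesis
      using False assms insertion_comp_inj[of m N 1 "hyperoct_desc N {m - 1}"]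
      by (simp only: sum.reindex) (simp add: comp_def)
  qed simp
  moreover have "(\<Sum>w\<in>?C. F w) = (\<Sum>u\<in>hyperoct_desc N {m}. F (u \<circ> insertion N (Suc m) (- 1)))"
  proof -
    have "?C = (\<lambda>u. u \<circ> insertion N (Suc m) (- 1)) ` hyperoct_desc N {m}"
      using hyperoct_desc_insertion_image[of "Suc m" N "- 1" m] assms by (simp add: algebra_simps)
    then show ?thesis
      using assms insertion_comp_inj[of "Suc m" N "- 1" "hyperoct_desc N {m}"]
      by (simp only: sum.reindex) (simp add: comp_def)
  qed
  ultimately show ?thesis by simp
qed

text \<open>Pairs avoiding the new entry come from \<open>u\<close>, with \<open>Q'\<close> the
  pullback of \<open>Q\<close> along the map that opens a gap at \<open>p\<close>. With the new
  entry on the right, all or none are inversions, according to \<open>s\<close>. With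
  \<open>p\<close> or \<open>- p\<close> on the left, each \<open>j\<close> is inverted with exactly
  one of them, \<open>s * p\<close>, so the last term is independent of \<open>s\<close>.\<close>

lemma card_invs_insertion:
  assumes u: "u \<in> hyperoct N" and p: "1 \<le> p" "p \<le> Suc N" and s: "\<bar>s\<bar> = 1"
    and Q': "\<And>a b. 0 \<le> a \<Longrightarrow> a < b \<Longrightarrow> b \<le> int N \<Longrightarrow>
      Q' a b \<longleftrightarrow> Q (if a < int p then a else a + 1) (if b < int p then b else b + 1)"
  shows "card (invs Q (Suc N) (u \<circ> insertion N p s)) = card (invs Q' N u) +
    (if s = 1 then 0 else card {i. \<bar>i\<bar> < int p \<and> Q \<bar>i\<bar> (int p)}) +
    card {j. int p < j \<and> j \<le> int N + 1 \<and> Q (int p) j}"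
proof -
  let ?f = "insertion N p s" and ?w = "u \<circ> insertion N p s"
  let ?I = "invs Q (Suc N) ?w"
  let ?X = "{(i, j) \<in> ?I. \<bar>i\<bar> \<noteq> int p \<and> j \<noteq> int p}"
  let ?Y = "{(i, j) \<in> ?I. j = int p}"
  let ?Z = "{(i, j) \<in> ?I. \<bar>i\<bar> = int p}"
  have s': "s = 1 \<or> s = - 1" using s by linarith
  have w_hyp: "?w \<in> hyperoct (Suc N)"
    using hyperoct_insertion_image[OF p s] u by blast
  have w_p: "?w (int p) = s * (int N + 1)" "?w (- int p) = - s * (int N + 1)"
    using hyperoct_insertion_value[OF u p(1) s] hyperoct_minus[OF w_hyp, of "int p"] by auto
  have f: "?f i = (if int p < \<bar>i\<bar> then i - sgn i else i)" if "\<bar>i\<bar> \<le> int N + 1" "\<bar>i\<bar> \<noteq> int p" for i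
    using that by (simp add: insertion_def)
  have f_le: "\<bar>?f i\<bar> \<le> int N" if "\<bar>i\<bar> \<le> int N + 1" "\<bar>i\<bar> \<noteq> int p" for i
    using that p by (auto simp: f sgn_if)
  have w_lt: "\<bar>?w i\<bar> < int N + 1" if "\<bar>i\<bar> \<le> int N + 1" "\<bar>i\<bar> \<noteq> int p" for i
    using hyperoct_abs_le[OF u, of "?f i"] f_le[OF that] by simp
  \<comment> \<open>Opens the gap at \<open>p\<close>; inverse to \<open>?f\<close> off the
    positions \<open>p\<close> and \<open>- p\<close>.\<close>
  define g where "g i = (if \<bar>i\<bar> < int p then i else i + sgn i)" for i
  have fg: "?f (g i) = i" if "\<bar>i\<bar> \<le> int N" for i
    using that p by (auto simp: insertion_def g_def sgn_if)
  have gf: "g (?f i) = i" if "\<bar>i\<bar> \<le> int N + 1" "\<bar>i\<bar> \<noteq> int p" for i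
    using that p by (auto simp: f g_def sgn_if)
  have g_abs: "\<bar>g i\<bar> = (if \<bar>i\<bar> < int p then \<bar>i\<bar> else \<bar>i\<bar> + 1)" for i
    using p by (auto simp: g_def sgn_if)
  have "bij_betw (\<lambda>(i, j). (?f i, ?f j)) ?X (invs Q' N u)"
  proof (rule bij_betw_byWitness[where f' = "\<lambda>(i, j). (g i, g j)"])
    show "\<forall>a\<in>?X. (\<lambda>(i, j). (g i, g j)) ((\<lambda>(i, j). (?f i, ?f j)) a) = a"
      using gf by (auto simp: invs_def)
    show "\<forall>a\<in>invs Q' N u. (\<lambda>(i, j). (?f i, ?f j)) ((\<lambda>(i, j). (g i, g j)) a) = a"
      using fg by (auto simp: invs_def)
    show "(\<lambda>(i, j). (?f i, ?f j)) ` ?X \<subseteq> invs Q' N u"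
    proof clarify
      fix i j assume "(i, j) \<in> ?I" and ne: "\<bar>i\<bar> \<noteq> int p" "j \<noteq> int p"
      then have ij: "\<bar>i\<bar> < j" "j \<le> int N + 1" "Q \<bar>i\<bar> j" "u (?f j) < u (?f i)"
        by (auto simp: invs_def)
      have abs_f: "\<bar>?f i\<bar> = (if \<bar>i\<bar> < int p then \<bar>i\<bar> else \<bar>i\<bar> - 1)"
        "?f j = (if j < int p then j else j - 1)"
        using ij ne p f[of i] f[of j] by (auto simp: sgn_if)
      then have lt: "\<bar>?f i\<bar> < ?f j" "?f j \<le> int N"
        using ij ne p by (auto split: if_splits)
      moreover have "Q' \<bar>?f i\<bar> (?f j)"
      proof -
        have "(if \<bar>?f i\<bar> < int p then \<bar>?f i\<bar> else \<bar>?f i\<bar> + 1) = \<bar>i\<bar>"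
          "(if ?f j < int p then ?f j else ?f j + 1) = j"
          using abs_f ne by auto
        then show ?thesis using Q'[OF _ lt] ij(3) by simp
      qed
      ultimately show "(?f i, ?f j) \<in> invs Q' N u" using ij(4) by (simp add: invs_def)
    qed
    show "(\<lambda>(i, j). (g i, g j)) ` invs Q' N u \<subseteq> ?X"
    proof clarify
      fix i j assume "(i, j) \<in> invs Q' N u"
      then have ij: "\<bar>i\<bar> < j" "j \<le> int N" "Q' \<bar>i\<bar> j" "u j < u i"
        by (auto simp: invs_def)
      have g_j: "g j = (if j < int p then j else j + 1)" using ij(1) by (auto simp: g_def sgn_if)
      have "Q \<bar>g i\<bar> (g j)" using Q'[of "\<bar>i\<bar>" j] ij by (simp add: g_abs g_j)
      moreover have "\<bar>g i\<bar> < g j" "g j \<le> int N + 1" "\<bar>g i\<bar> \<noteq> int p" "g j \<noteq> int p"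
        using ij by (auto simp: g_abs g_j)
      moreover have "?w (g j) < ?w (g i)" using ij fg[of i] fg[of j] by simp
      ultimately show "(g i, g j) \<in> ?I \<and> \<bar>g i\<bar> \<noteq> int p \<and> g j \<noteq> int p"
        by (simp add: invs_def)
    qed
  qed
  then have X: "card ?X = card (invs Q' N u)" by (rule bij_betw_same_card)
  have Y: "card ?Y = (if s = 1 then 0 else card {i. \<bar>i\<bar> < int p \<and> Q \<bar>i\<bar> (int p)})"
  proof -
    have "?Y = (if s = 1 then {} else (\<lambda>i. (i, int p)) ` {i. \<bar>i\<bar> < int p \<and> Q \<bar>i\<bar> (int p)})"
    proof -
      have "?w (int p) < ?w i \<longleftrightarrow> s \<noteq> 1" if "\<bar>i\<bar> < int p" for i
      proof -
        have "\<bar>?w i\<bar> < int N + 1" using that p by (intro w_lt) auto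
        then show ?thesis using s' w_p(1) by (cases "s = 1") (simp_all del: comp_apply)
      qed
      then show ?thesis using p by (auto simp: invs_def)
    qed
    then show ?thesis by (simp add: card_image inj_on_def)
  qed
  have Z: "card ?Z = card {j. int p < j \<and> j \<le> int N + 1 \<and> Q (int p) j}"
  proof -
    have less: "?w j < ?w i \<longleftrightarrow> i = s * int p" if "\<bar>i\<bar> = int p" "int p < j" "j \<le> int N + 1" for i j
    proof -
      have i: "i = int p \<or> i = - int p" using that(1) by linarith
      have "\<bar>?w j\<bar> < int N + 1" using that p by (intro w_lt) auto
      then show ?thesis using i s' w_p p by (cases "s = 1") (auto simp del: comp_apply)
    qed
    have "?Z = (\<lambda>j. (s * int p, j)) ` {j. int p < j \<and> j \<le> int N + 1 \<and> Q (int p) j}"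
    proof (intro set_eqI iffI)
      fix x assume "x \<in> ?Z"
      then show "x \<in> (\<lambda>j. (s * int p, j)) ` {j. int p < j \<and> j \<le> int N + 1 \<and> Q (int p) j}"
        using less by (auto simp: invs_def)
    next
      fix x assume "x \<in> (\<lambda>j. (s * int p, j)) ` {j. int p < j \<and> j \<le> int N + 1 \<and> Q (int p) j}"
      then obtain j where j: "x = (s * int p, j)" "int p < j" "j \<le> int N + 1" "Q (int p) j"
        by auto
      have "\<bar>s * int p\<bar> = int p" using s by (simp add: abs_mult)
      then show "x \<in> ?Z" using j less[of "s * int p" j] by (simp add: invs_def)
    qed
    then show ?thesis by (simp add: card_image inj_on_def)
  qed
  have fin: "finite ?X" "finite ?Y" "finite ?Z"
    by (rule finite_subset[OF _ finite_invs[of Q "Suc N" ?w]]; auto)+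
  have "?I = ?X \<union> ?Y \<union> ?Z" by auto
  moreover have "card (?X \<union> ?Y \<union> ?Z) = card (?X \<union> ?Y) + card ?Z"
    by (rule card_Un_disjoint) (use fin in \<open>auto simp: invs_def\<close>)
  moreover have "card (?X \<union> ?Y) = card ?X + card ?Y"
    by (rule card_Un_disjoint) (use fin in auto)
  ultimately show ?thesis using X Y Z by simp
qed

text \<open>
  For \<open>d = True\<close> the parity condition is reversed for the pairs that straddle \<open>m\<close>: inserting a value
  at position \<open>m\<close> or \<open>m + 1\<close> shifts the positions to the right by one.
\<close>
definition block_pairs :: "bool \<Rightarrow> nat \<Rightarrow> int \<Rightarrow> int \<Rightarrow> bool" where
  "block_pairs d m a b \<longleftrightarrow> odd (a + b) \<noteq> (d \<and> a \<le> int m \<and> int m < b)"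

text \<open>Opening the gap changes the parity of \<open>a + b\<close> exactly if
  \<open>a < p \<le> b\<close>. These are the pairs straddling \<open>p - 1\<close> before and
  \<open>m\<close> after the shift; no position is sent to \<open>p\<close>, so \<open>m = p\<close>
  and \<open>m = p - 1\<close> give the same condition.\<close>

lemma block_pairs_insertion:
  assumes "1 \<le> p" "m = p \<or> m = p - 1" "a < b"
  shows "block_pairs (\<not> d) (p - 1) a b \<longleftrightarrow>
    block_pairs d m (if a < int p then a else a + 1) (if b < int p then b else b + 1)"
  using assms by (auto simp: block_pairs_def of_nat_diff)

section \<open>Parity counts and weights under insertion\<close>

lemma card_odd_offset: "card {j::int. c < j \<and> j \<le> c + int k \<and> odd (c + j)} = (k + 1) div 2"
proof (induction k)
  case 0
  have "{j. c < j \<and> j \<le> c + int 0 \<and> odd (c + j)} = {}" by auto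
  then show ?case by (simp only: card.empty)
next
  case (Suc k)
  let ?S = "\<lambda>k. {j. c < j \<and> j \<le> c + int k \<and> odd (c + j)}"
  have fin: "finite (?S k)" by (rule finite_subset[of _ "{c..c + int k}"]) auto
  have "?S (Suc k) = (if even k then insert (c + int k + 1) (?S k) else ?S k)"
    by (auto simp: le_less)
  then show ?case using fin Suc by (auto elim!: evenE oddE)
qed

lemma card_even_offset: "card {j::int. c < j \<and> j \<le> c + int k \<and> even (c + j)} = k div 2"
proof -
  let ?E = "{j::int. c < j \<and> j \<le> c + int k \<and> even (c + j)}"
  let ?O = "{j::int. c < j \<and> j \<le> c + int k \<and> odd (c + j)}"
  have "card (?E \<union> ?O) = card ?E + card ?O"
    by (rule card_Un_disjoint) (auto intro: finite_subset[of _ "{c..c + int k}"])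
  moreover have "?E \<union> ?O = {c<..c + int k}" by auto
  ultimately show ?thesis using card_odd_offset[of c k] by simp
qed

text \<open>From \<open>m\<close> to \<open>m + 1\<close> the two classes change places and the two
  new ends join the even one.\<close>

lemma card_symmetric_parity:
  "card {i::int. \<bar>i\<bar> \<le> int m \<and> even (i + int m)} = m + 1 \<and>
   card {i::int. \<bar>i\<bar> \<le> int m \<and> odd (i + int m)} = m"
proof (induction m)
  case 0
  have "{i::int. \<bar>i\<bar> \<le> int 0 \<and> even (i + int 0)} = {0}"
    "{i::int. \<bar>i\<bar> \<le> int 0 \<and> odd (i + int 0)} = {}" by auto
  then show ?case by (simp only: card.empty card.insert) simp
next
  case (Suc m)
  let ?E = "\<lambda>m. {i::int. \<bar>i\<bar> \<le> int m \<and> even (i + int m)}"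
  let ?O = "\<lambda>m. {i::int. \<bar>i\<bar> \<le> int m \<and> odd (i + int m)}"
  have fin: "finite (?O m)" by (rule finite_subset[of _ "{- int m..int m}"]) auto
  have "i \<in> ?E (Suc m) \<longleftrightarrow> i \<in> insert (int m + 1) (insert (- int m - 1) (?O m))" for i
  proof -
    consider "\<bar>i\<bar> \<le> int m" | "i = int m + 1" | "i = - int m - 1" | "\<bar>i\<bar> > int m + 1" by linarith
    then show ?thesis by cases auto
  qed
  then have "?E (Suc m) = insert (int m + 1) (insert (- int m - 1) (?O m))" by blast
  moreover have "i \<in> ?O (Suc m) \<longleftrightarrow> i \<in> ?E m" for i
  proof -
    consider "\<bar>i\<bar> \<le> int m" | "i = int m + 1" | "i = - int m - 1" | "\<bar>i\<bar> > int m + 1" by linarith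
    then show ?thesis by cases auto
  qed
  then have "?O (Suc m) = ?E m" by blast
  moreover have "card (insert (int m + 1) (insert (- int m - 1) (?O m))) = Suc (Suc (card (?O m)))"
    using fin by (simp add: card_insert_if)
  ultimately show ?case using Suc by simp
qed

definition block_sum :: "bool \<Rightarrow> nat \<Rightarrow> nat \<Rightarrow> int poly" where
  "block_sum d m k = (\<Sum>u\<in>hyperoct_desc (m + k) {m}. weight (block_pairs d m) (m + k) u)"

lemma weight_Suc_fixed:
  assumes u: "u \<in> hyperoct N" shows "weight Q (Suc N) u = weight Q N u"
proof -
  have "invs R (Suc N) u = invs R N u" for R
  proof -
    have "\<not> u (int N + 1) < u i" if "\<bar>i\<bar> < int N + 1" for i
      using hyperoct_abs_le[OF u, of i] hyperoct_fixed[OF u, of "int N + 1"] that by auto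
    moreover have "j \<le> int (Suc N) \<longleftrightarrow> j \<le> int N \<or> j = int N + 1" for j by auto
    ultimately show ?thesis by (auto simp: invs_def)
  qed
  then show ?thesis by (simp add: weight_def cox_sign_def)
qed

text \<open>The new inversions are one for each of the \<open>k\<close> positions to the right of
  \<open>m\<close>. All these pairs straddle \<open>m\<close>, so \<open>d\<close> decides whether
  odd or even distances count.\<close>

lemma weight_insertion_max:
  assumes u: "u \<in> hyperoct N" and m: "1 \<le> m" and k: "m + k = Suc N"
  shows "weight (block_pairs d m) (Suc N) (u \<circ> insertion N m 1) =
    (- 1) ^ k * monom 1 (if d then k div 2 else (k + 1) div 2) *
      weight (block_pairs (\<not> d) (m - 1)) N u"
proof -
  have N: "int N + 1 = int m + int k" using k by linarith
  have m_le: "m \<le> Suc N" using k by simp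
  have "card (invs (block_pairs d m) (Suc N) (u \<circ> insertion N m 1)) =
      card (invs (block_pairs (\<not> d) (m - 1)) N u) +
      card {j. int m < j \<and> j \<le> int m + int k \<and> block_pairs d m (int m) j}"
    using card_invs_insertion[OF u m m_le, of 1 "block_pairs (\<not> d) (m - 1)" "block_pairs d m"]
      block_pairs_insertion[of m m _ _ d] m unfolding N by simp
  moreover have "{j. int m < j \<and> j \<le> int m + int k \<and> block_pairs d m (int m) j} =
      (if d then {j. int m < j \<and> j \<le> int m + int k \<and> even (int m + j)}
       else {j. int m < j \<and> j \<le> int m + int k \<and> odd (int m + j)})"
    unfolding block_pairs_def by auto
  ultimately have 1: "card (invs (block_pairs d m) (Suc N) (u \<circ> insertion N m 1)) =
      card (invs (block_pairs (\<not> d) (m - 1)) N u) + (if d then k div 2 else (k + 1) div 2)"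
    using card_even_offset[of "int m" k] card_odd_offset[of "int m" k] by (cases d) (simp_all only: if_True if_False)
  have "{j. int m < j \<and> j \<le> int m + int k} = {int m<..int m + int k}" by auto
  then have 2: "card (invs all_pairs (Suc N) (u \<circ> insertion N m 1)) = card (invs all_pairs N u) + k"
    using card_invs_insertion[OF u m m_le, of 1 all_pairs all_pairs] unfolding N by simp
  show ?thesis
    unfolding weight_def cox_sign_def 1 2 power_add
    by (simp add: mult_monom[of 1 _ "1::int", simplified, symmetric] mult_ac)
qed

text \<open>There is one new inversion for each of the \<open>2 * m + 1\<close> positions from
  \<open>- m\<close> to \<open>m\<close> and one for each of the \<open>k - 1\<close> positions to
  the right of \<open>m + 1\<close>, in all \<open>2 * m + k\<close>; hence the sign. The former
  pairs straddle \<open>m\<close>, the latter do not, so \<open>d\<close> affects only the first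
  count.\<close>

lemma weight_insertion_min:
  assumes u: "u \<in> hyperoct N" and k: "m + k = Suc N" "1 \<le> k"
  shows "weight (block_pairs d m) (Suc N) (u \<circ> insertion N (Suc m) (- 1)) =
    (- 1) ^ k * monom 1 ((if d then m else m + 1) + k div 2) *
      weight (block_pairs (\<not> d) m) N u"
proof -
  let ?w = "u \<circ> insertion N (Suc m) (- 1)"
  obtain k' where k': "k = Suc k'" using k(2) by (cases k) auto
  have N: "int N + 1 = int (Suc m) + int k'" using k k' by linarith
  have m_le: "Suc m \<le> Suc N" using k by simp
  have total: "card (invs (block_pairs d m) (Suc N) ?w) =
      card (invs (block_pairs (\<not> d) m) N u) +
      card {i. \<bar>i\<bar> < int (Suc m) \<and> block_pairs d m \<bar>i\<bar> (int (Suc m))} +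
      card {j. int (Suc m) < j \<and> j \<le> int (Suc m) + int k' \<and> block_pairs d m (int (Suc m)) j}"
    using card_invs_insertion[OF u _ m_le, of "- 1" "block_pairs (\<not> d) m" "block_pairs d m"]
      block_pairs_insertion[of "Suc m" m _ _ d] unfolding N by simp
  have inner: "{i. \<bar>i\<bar> < int (Suc m) \<and> block_pairs d m \<bar>i\<bar> (int (Suc m))} =
      (if d then {i. \<bar>i\<bar> \<le> int m \<and> odd (i + int m)} else {i. \<bar>i\<bar> \<le> int m \<and> even (i + int m)})"
    unfolding block_pairs_def by auto
  have outer: "{j. int (Suc m) < j \<and> j \<le> int (Suc m) + int k' \<and> block_pairs d m (int (Suc m)) j} =
      {j. int (Suc m) < j \<and> j \<le> int (Suc m) + int k' \<and> odd (int (Suc m) + j)}"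
    unfolding block_pairs_def by auto
  have inner_card: "card {i. \<bar>i\<bar> < int (Suc m) \<and> block_pairs d m \<bar>i\<bar> (int (Suc m))} =
      (if d then m else m + 1)"
    unfolding inner using card_symmetric_parity[of m] by (cases d) (simp_all only: if_True if_False)
  have 1: "card (invs (block_pairs d m) (Suc N) ?w) =
      card (invs (block_pairs (\<not> d) m) N u) + ((if d then m else m + 1) + k div 2)"
    unfolding total inner_card outer card_odd_offset k' by simp
  have "{j. int (Suc m) < j \<and> j \<le> int (Suc m) + int k'} = {int (Suc m)<..int (Suc m) + int k'}"
    "{i. \<bar>i\<bar> < int (Suc m)} = {- int m..int m}" by auto
  then have cards: "card {j. int (Suc m) < j \<and> j \<le> int (Suc m) + int k'} = k'"
    "card {i. \<bar>i\<bar> < int (Suc m)} = 2 * m + 1" by simp_all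
  have "card (invs all_pairs (Suc N) ?w) = card (invs all_pairs N u) +
      card {i. \<bar>i\<bar> < int (Suc m)} + card {j. int (Suc m) < j \<and> j \<le> int (Suc m) + int k'}"
    using card_invs_insertion[OF u _ m_le, of "- 1" all_pairs all_pairs] unfolding N by simp
  then have 2: "card (invs all_pairs (Suc N) ?w) = card (invs all_pairs N u) + (2 * m + k)"
    unfolding cards k' by simp
  show ?thesis
    unfolding weight_def cox_sign_def 1 2 power_add
    by (simp add: mult_monom[of 1 _ "1::int", simplified, symmetric] mult_ac)
qed

text \<open>The term with \<open>m - 1\<close> keeps the last argument at \<open>Suc k\<close>;
  solving the recursion therefore takes an induction on \<open>m\<close> inside one on
  \<open>k\<close>.\<close>

lemma block_sum_Suc:
  "block_sum d m (Suc k) = block_sum d m k +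
    (if m = 0 then 0
     else (- 1) ^ Suc k * monom 1 (if d then Suc k div 2 else (Suc k + 1) div 2) *
       block_sum (\<not> d) (m - 1) (Suc k)) +
    (- 1) ^ Suc k * monom 1 ((if d then m else m + 1) + Suc k div 2) * block_sum (\<not> d) m k"
proof -
  let ?N = "m + k"
  have hyp: "u \<in> hyperoct ?N" if "u \<in> hyperoct_desc ?N J" for u J
    using that by (simp add: hyperoct_desc_iff)
  have "block_sum d m (Suc k) = (\<Sum>u\<in>hyperoct_desc (Suc ?N) {m}. weight (block_pairs d m) (Suc ?N) u)"
    by (simp add: block_sum_def)
  also have "\<dots> = (\<Sum>u\<in>hyperoct_desc ?N {m}. weight (block_pairs d m) (Suc ?N) u) +
    (if m = 0 then 0 else \<Sum>u\<in>hyperoct_desc ?N {m - 1}.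
       weight (block_pairs d m) (Suc ?N) (u \<circ> insertion ?N m 1)) +
    (\<Sum>u\<in>hyperoct_desc ?N {m}. weight (block_pairs d m) (Suc ?N) (u \<circ> insertion ?N (Suc m) (- 1)))"
    by (rule sum_hyperoct_desc_Suc) simp
  also have "(\<Sum>u\<in>hyperoct_desc ?N {m}. weight (block_pairs d m) (Suc ?N) u) = block_sum d m k"
    unfolding block_sum_def by (rule sum.cong) (auto dest: hyp simp: weight_Suc_fixed)
  also have "(\<Sum>u\<in>hyperoct_desc ?N {m}.
        weight (block_pairs d m) (Suc ?N) (u \<circ> insertion ?N (Suc m) (- 1))) =
      (- 1) ^ Suc k * monom 1 ((if d then m else m + 1) + Suc k div 2) * block_sum (\<not> d) m k"
    unfolding block_sum_def sum_distrib_left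
    by (rule sum.cong[OF refl], rule weight_insertion_min) (auto dest: hyp)
  also have "(if m = 0 then 0 else \<Sum>u\<in>hyperoct_desc ?N {m - 1}.
        weight (block_pairs d m) (Suc ?N) (u \<circ> insertion ?N m 1)) =
      (if m = 0 then 0
       else (- 1) ^ Suc k * monom 1 (if d then Suc k div 2 else (Suc k + 1) div 2) *
         block_sum (\<not> d) (m - 1) (Suc k))"
  proof (cases "m = 0")
    case False
    then have N: "m - 1 + Suc k = ?N" by simp
    have "(\<Sum>u\<in>hyperoct_desc ?N {m - 1}. weight (block_pairs d m) (Suc ?N) (u \<circ> insertion ?N m 1)) =
        (- 1) ^ Suc k * monom 1 (if d then Suc k div 2 else (Suc k + 1) div 2) *
          block_sum (\<not> d) (m - 1) (Suc k)"
      unfolding block_sum_def sum_distrib_left N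
      by (rule sum.cong[OF refl], rule weight_insertion_max) (use False in \<open>auto dest: hyp\<close>)
    then show ?thesis using False by (simp only: if_False)
  qed simp
  finally show ?thesis .
qed

section \<open>Closed form\<close>

lemma qnum_pos: "k > 0 \<Longrightarrow> qnum k = 1 - monom 1 k"
  by (simp add: qnum_def)

lemma qnum_nonzero: "qnum k \<noteq> 0"
proof
  assume "qnum k = 0"
  then have "coeff (qnum k) 0 = 0" by simp
  then show False by (simp add: qnum_def split: if_splits)
qed

lemma qfact_nonzero: "qfact k \<noteq> 0"
  by (simp add: qfact_def qnum_nonzero)

lemma qdfact_nonzero: "qdfact k \<noteq> 0"
  by (simp add: qdfact_def qnum_nonzero)

lemma qfact_Suc: "qfact (Suc k) = qfact k * (1 - monom 1 (Suc k))"
  by (simp add: qfact_def qnum_pos)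

lemma qdfact_0: "qdfact 0 = 1"
  by (simp add: qdfact_def)

lemma qdfact_Suc: "qdfact (Suc k) = (if even (Suc k) then qdfact k * (1 - monom 1 (Suc k)) else qdfact k)"
proof -
  have "{i \<in> {1..Suc k}. even i} =
      (if even (Suc k) then insert (Suc k) {i \<in> {1..k}. even i} else {i \<in> {1..k}. even i})"
    by (auto simp: le_Suc_eq)
  then show ?thesis by (simp add: qdfact_def qnum_pos mult.commute del: even_Suc)
qed

lemma weight_id: "weight Q n id = 1"
proof -
  have "invs R n id = {}" for R by (auto simp: invs_def)
  then show ?thesis by (simp add: weight_def cox_sign_def)
qed

lemma block_sum_0: "block_sum d m 0 = 1"
  using hyperoct_desc_no_descents[of "{m}" m] by (simp add: block_sum_def weight_id del: id_apply)

text \<open>The first identity is the one-element case of \<open>f_frac\<close> with denominators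
  cleared. The recursion exchanges the two values of \<open>d\<close>, which forces the second
  identity into the same induction.\<close>

lemma block_sum_closed_form:
  "block_sum False m k * (qfact m * qdfact k) = qfact (m + k) \<and>
   block_sum True m k = (if even k then monom 1 (k div 2) * block_sum False m k else 0)"
proof (induction k arbitrary: m)
  case 0
  show ?case by (simp add: block_sum_0 qdfact_0 one_pCons monom_0)
next
  case (Suc k)
  let ?M = "\<lambda>e. monom (1::int) e" and ?K = "Suc k"
  have M_add: "?M (e + e') = ?M e * ?M e'" for e e' by (simp add: mult_monom)
  \<comment> \<open>\<open>b\<close> and \<open>b1\<close> stand for the sums at
    \<open>m - 1\<close>. In the hypothesis on \<open>b\<close> the factor \<open>1 - ?M m\<close>
    vanishes for \<open>m = 0\<close>, so \<open>b = b1 = 0\<close> covers the case in which the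
    recursion lacks that term.\<close>
  have step: "block_sum False m ?K * (qfact m * qdfact ?K) = qfact (m + ?K) \<and>
      block_sum True m ?K = (if even ?K then ?M (?K div 2) * block_sum False m ?K else 0)"
    if b: "b * (qfact m * qdfact ?K) = qfact (m + k) * (1 - ?M m)"
      and b1: "b1 = (if even ?K then ?M (?K div 2) * b else 0)"
      and rec0: "block_sum False m ?K = block_sum False m k +
        (- 1) ^ ?K * ?M ((?K + 1) div 2) * b1 +
        (- 1) ^ ?K * ?M (m + 1 + ?K div 2) * block_sum True m k"
      and rec1: "block_sum True m ?K = block_sum True m k +
        (- 1) ^ ?K * ?M (?K div 2) * b + (- 1) ^ ?K * ?M (m + ?K div 2) * block_sum False m k"
    for m b b1
  proof -
    define a where "a = block_sum False m k"
    have a: "a * (qfact m * qdfact k) = qfact (m + k)"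
      and a1: "block_sum True m k = (if even k then ?M (k div 2) * a else 0)"
      using Suc[of m] by (simp_all add: a_def)
    have F: "qfact (m + ?K) = qfact (m + k) * (1 - ?M m * ?M ?K)"
      using qfact_Suc[of "m + k"] M_add[of m ?K] by simp
    have nz: "qfact m * qdfact ?K \<noteq> 0" by (simp add: qfact_nonzero qdfact_nonzero)
    show ?thesis
    proof (cases "even ?K")
      case True
      then obtain h where h: "?K = 2 * h" by (elim evenE)
      have half: "?K div 2 = h" "(?K + 1) div 2 = h" using h by simp_all
      have "odd k" using True by simp
      have MK: "?M ?K = ?M h * ?M h" using M_add[of h h] by (simp add: h mult_2)
      have D: "qdfact ?K = qdfact k * (1 - ?M ?K)" using True qdfact_Suc[of k] by simp
      have aK: "a * (qfact m * qdfact ?K) = qfact (m + k) * (1 - ?M ?K)"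
        using a unfolding D by (simp add: mult_ac)
      have sgn: "(- 1 :: int poly) ^ ?K = 1" using True by (simp only: h power_minus1_even)
      \<comment> \<open>After clearing denominators, \<open>t0\<close> and the bracket in
        \<open>t1\<close> are the two forms of q-Pascal: \<open>(1 - X^K) + X^K (1 - X^m)\<close>
        and \<open>(1 - X^m) + X^m (1 - X^K)\<close> both equal
        \<open>1 - X^(m + K)\<close>.\<close>
      have t0: "block_sum False m ?K = a + ?M ?K * b"
        using rec0 b1 a1 True unfolding half sgn MK a_def[symmetric] by (simp add: \<open>odd k\<close>)
      have t1: "block_sum True m ?K = ?M h * (b + ?M m * a)"
        using rec1 a1 unfolding half sgn a_def[symmetric] M_add by (simp add: \<open>odd k\<close> algebra_simps)
      have "block_sum False m ?K * (qfact m * qdfact ?K) =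
          a * (qfact m * qdfact ?K) + ?M ?K * (b * (qfact m * qdfact ?K))"
        unfolding t0 by (simp only: distrib_right mult.assoc)
      also have "\<dots> = qfact (m + ?K)" unfolding aK b F by (simp add: algebra_simps)
      finally have 1: "block_sum False m ?K * (qfact m * qdfact ?K) = qfact (m + ?K)" .
      have "(b + ?M m * a) * (qfact m * qdfact ?K) =
          b * (qfact m * qdfact ?K) + ?M m * (a * (qfact m * qdfact ?K))"
        by (simp only: distrib_right mult.assoc)
      also have "\<dots> = qfact (m + ?K)" unfolding aK b F by (simp add: algebra_simps)
      finally have "b + ?M m * a = block_sum False m ?K"
        using 1 nz by (metis mult_right_cancel)
      then show ?thesis using 1 t1 True half by simp
    next
      case False
      then have "even k" by simp
      then obtain h where h: "k = 2 * h" by (elim evenE)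
      have half: "?K div 2 = h" "k div 2 = h" using h by auto
      have MK: "?M ?K = ?M 1 * (?M h * ?M h)"
        using M_add[of h h] M_add[of 1 k] by (simp add: h mult_2)
      have D: "qdfact ?K = qdfact k" using False qdfact_Suc[of k] by simp
      have sgn: "(- 1 :: int poly) ^ ?K = - 1" by (simp only: h power_minus1_odd)
      \<comment> \<open>For odd \<open>?K\<close> the term with \<open>b1\<close> vanishes, and the
        variant at \<open>k = 2 * h\<close> contributes the exponent
        \<open>(m + 1 + h) + h = m + ?K\<close>.\<close>
      have t0: "block_sum False m ?K = a * (1 - ?M m * ?M ?K)"
        using rec0 b1 a1 False \<open>even k\<close> unfolding half sgn MK a_def[symmetric] M_add
        by (simp add: algebra_simps)
      have "block_sum False m ?K * (qfact m * qdfact ?K) =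
          a * (qfact m * qdfact k) * (1 - ?M m * ?M ?K)"
        unfolding t0 D by (simp only: mult_ac)
      then have 1: "block_sum False m ?K * (qfact m * qdfact ?K) = qfact (m + ?K)"
        unfolding a F .
      \<comment> \<open>This is why the variant vanishes for odd \<open>?K\<close>: its three terms
        add up to \<open>X^h * (a * (1 - X^m) - b)\<close>.\<close>
      have "a * (1 - ?M m) * (qfact m * qdfact ?K) = a * (qfact m * qdfact k) * (1 - ?M m)"
        unfolding D by (simp only: mult_ac)
      also have "\<dots> = b * (qfact m * qdfact ?K)" unfolding a b ..
      finally have "a * (1 - ?M m) = b" using nz by (metis mult_right_cancel)
      moreover have "block_sum True m ?K = ?M h * (a * (1 - ?M m) - b)"
        using rec1 a1 \<open>even k\<close> unfolding half sgn a_def[symmetric] M_add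
        by (simp add: algebra_simps)
      ultimately have "block_sum True m ?K = 0" by simp
      then show ?thesis using 1 False by simp
    qed
  qed
  show ?case
  proof (induction m)
    case 0
    show ?case
      by (rule step[of 0 0 0]; (subst block_sum_Suc)?) (simp_all add: monom_0 one_pCons)
  next
    case (Suc m')
    have F: "qfact (Suc m') = qfact m' * (1 - ?M (Suc m'))" by (rule qfact_Suc)
    show ?case
    proof (rule step)
      have "block_sum False m' ?K * (qfact m' * (1 - ?M (Suc m')) * qdfact ?K) =
          block_sum False m' ?K * (qfact m' * qdfact ?K) * (1 - ?M (Suc m'))"
        by (simp only: mult_ac)
      moreover have "block_sum False m' ?K * (qfact m' * qdfact ?K) = qfact (Suc m' + k)"
        using Suc by simp
      ultimately show "block_sum False m' ?K * (qfact (Suc m') * qdfact ?K) =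
          qfact (Suc m' + k) * (1 - ?M (Suc m'))"
        unfolding F by (simp only:)
      show "block_sum True m' ?K = (if even ?K then ?M (?K div 2) * block_sum False m' ?K else 0)"
        using Suc by blast
      show "block_sum False (Suc m') ?K = block_sum False (Suc m') k +
          (- 1) ^ ?K * ?M ((?K + 1) div 2) * block_sum True m' ?K +
          (- 1) ^ ?K * ?M (Suc m' + 1 + ?K div 2) * block_sum True (Suc m') k"
        using block_sum_Suc[of False "Suc m'" k] by simp
      show "block_sum True (Suc m') ?K = block_sum True (Suc m') k +
          (- 1) ^ ?K * ?M (?K div 2) * block_sum False m' ?K +
          (- 1) ^ ?K * ?M (Suc m' + ?K div 2) * block_sum False (Suc m') k"
        using block_sum_Suc[of True "Suc m'" k] by simp
    qed
  qed
qed

lemma signed_sum_singleton: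
  assumes "m < n"
  shows "signed_sum n {m} * (qfact m * qdfact (n - m)) = qfact n"
proof -
  have "block_pairs False m = odd_pairs" by (simp add: fun_eq_iff block_pairs_def odd_pairs_def)
  then have "signed_sum n {m} = block_sum False m (n - m)"
    using assms by (simp add: signed_sum_def block_sum_def)
  then show ?thesis using block_sum_closed_form[of m "n - m"] assms by simp
qed

section \<open>The quotient \<open>f_frac\<close> under adding a largest element\<close>

lemma sorted_list_of_set_insert_max:
  fixes J :: "nat set"
  assumes "J \<subseteq> {0..<m}"
  shows "sorted_list_of_set (insert m J) = sorted_list_of_set J @ [m]"
proof -
  have fin: "finite J" using assms finite_subset by blast
  have "m \<notin> J" using assms by auto
  then show ?thesis
    using sorted_list_of_set_unique[of "insert m J" "sorted_list_of_set J @ [m]"] fin assms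
    by (auto simp: sorted_wrt_append subset_iff)
qed

text \<open>The last gap of \<open>J\<close> at rank \<open>m\<close> ends at \<open>m\<close>, so
  it is already the gap between the largest element of \<open>J\<close> and the new one; only
  \<open>n - m\<close> is added, and the numerator \<open>qfact m\<close> of
  \<open>f_frac m J\<close> cancels. For \<open>J = {}\<close> the factor \<open>qfact m\<close>
  stays, since \<open>m\<close> is then the first element.\<close>

lemma f_frac_insert:
  assumes "m < n" and J: "J \<subseteq> {0..<m}"
  shows "f_frac n (insert m J) =
    to_fract (qfact n) / to_fract (qfact m * qdfact (n - m)) * f_frac m J"
proof -
  have fin: "finite J" using J finite_subset by blast
  have card: "card (insert m J) = Suc (card J)" using J fin by (subst card_insert_disjoint) auto
  have elt_J: "elt (insert m J) t = elt J t" if "1 \<le> t" "t \<le> card J" for t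
  proof -
    have "t - 1 < card J" using that by linarith
    then show ?thesis
      using fin by (simp add: elt_def sorted_list_of_set_insert_max[OF J] nth_append)
  qed
  have elt_last: "elt (insert m J) (Suc (card J)) = m"
    using fin by (simp add: elt_def sorted_list_of_set_insert_max[OF J] nth_append)
  show ?thesis
  proof (cases "J = {}")
    case True
    then show ?thesis using elt_last by (simp add: f_frac_def gap_def)
  next
    case False
    then have pos: "1 \<le> card J" using fin by (simp add: Suc_le_eq card_gt_0_iff)
    have gap_J: "gap n (insert m J) t = gap m J t" if "1 \<le> t" "t \<le> card J" for t
      using that elt_J[of t] elt_J[of "t + 1"] elt_last
      by (cases "t = card J") (auto simp: gap_def card)
    have gap_last: "gap n (insert m J) (Suc (card J)) = n - m"
      by (simp add: gap_def card elt_last)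
    have "(\<Prod>t = 1..card (insert m J). qdfact (gap n (insert m J) t)) =
        (\<Prod>t = 1..card J. qdfact (gap m J t)) * qdfact (n - m)"
      unfolding card using gap_J by (simp add: gap_last prod.nat_ivl_Suc')
    moreover have "to_fract (qfact m) \<noteq> 0" by (simp add: qfact_nonzero)
    ultimately show ?thesis
      using False elt_J[of 1] pos by (simp add: f_frac_def field_simps)
  qed
qed

text \<open>The largest element is split off; \<open>n\<close> is arbitrary because the remaining
  set is then treated at rank \<open>m\<close>.\<close>

lemma signed_sum_eq_f_frac:
  assumes "I \<subseteq> {0..<n}"
  shows "to_fract (signed_sum n I) = f_frac n I"
proof -
  have "finite I" using assms finite_subset by blast
  then show ?thesis using assms
  proof (induction I arbitrary: n rule: finite_linorder_max_induct)
    case empty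
    then show ?case
      by (simp add: signed_sum_def hyperoct_desc_no_descents weight_id f_frac_def del: id_apply)
  next
    case (insert m J)
    have m: "m < n" and J: "J \<subseteq> {0..<m}" using insert by auto
    have "to_fract (signed_sum n {m}) * to_fract (qfact m * qdfact (n - m)) = to_fract (qfact n)"
      using arg_cong[OF signed_sum_singleton[OF m], of to_fract] by simp
    moreover have "to_fract (qfact m * qdfact (n - m)) \<noteq> 0"
      by (simp add: qfact_nonzero qdfact_nonzero)
    ultimately have "to_fract (signed_sum n {m}) =
        to_fract (qfact n) / to_fract (qfact m * qdfact (n - m))"
      by (simp add: eq_divide_eq)
    then show ?case
      using insert.IH[OF J] by (simp add: signed_sum_insert[OF m J] f_frac_insert[OF m J])
  qed
qed

theorem theorem2p16:
  fixes n :: nat and I :: "nat set"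
  assumes "n \<ge> 1" and "I \<subseteq> {0..n - 1}"
  shows "to_fract (\<Sum>w\<in>hyperoct_desc n I. (- 1) ^ coxeter_length n w * monom 1 (odd_length n w)) =
         f_frac n I"
proof -
  have "I \<subseteq> {0..<n}" using assms by (auto simp: subset_iff)
  then show ?thesis by (simp only: signed_sum_eq signed_sum_eq_f_frac)
qed

end
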